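(* Let $n,k$ be positive integers and let $G$ be a starlike tree on $n$ vertices whose central vertex $u$ is adjacent to one end of each of $h\geq 3$ paths (branches) $P_{a_1},\ldots,P_{a_h}$ (so $G-u$ is the disjoint union of these paths), where $a_i$ is even for $1\le i\le h-1$, $a_1=a_2=k\geq 2$, and $a_h<n/2$ is odd. Let $G'$ be the graph obtained from $G$ by adding an edge between the two vertices at distance $k$ from $u$ in the branches $P_{a_1}$ and $P_{a_2}$ (i.e. between the far endpoints of these two branches). Then $LE(G)=LE(G')$.
   Context: For a graph $G$ on $n$ vertices with Laplacian eigenvalues $\mu_1\ge\cdots\ge\mu_n$ (eigenvalues of $L=D-A$, $D$ the diagonal degree matrix, $A$ the adjacency matrix) and average degree $\overline{d}$, the Laplacian energy is $LE(G)=\sum_{i=1}^n|\mu_i-\overline{d}|$. $P_a$ denotes the path on $a$ vertices. (In the paper, $G'$ is denoted $\mathcal{E}_{e_1}(G)$ and such $G$ form the class $\mathcal{S}_{n,k}$.) *)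

theory Defs
  imports
    "Graph_Theory.Pair_Digraph"
    "Jordan_Normal_Form.Char_Poly"
begin

text \<open>
  A finite simple graph is a \<^term>\<open>pair_graph\<close>: an edge between \<open>v\<close> and \<open>w\<close> is represented by the
  two arcs \<open>(v, w)\<close> and \<open>(w, v)\<close>, so the out-degree is the degree in the undirected sense.
\<close>

abbreviation vertex_degree :: "'a pair_pre_digraph \<Rightarrow> 'a \<Rightarrow> nat" where
  "vertex_degree G v \<equiv> out_degree (with_proj G) v"

definition average_degree :: "'a pair_pre_digraph \<Rightarrow> real" where
  "average_degree G = (\<Sum>v\<in>pverts G. real (vertex_degree G v)) / real (card (pverts G))"

definition add_edge :: "'a pair_pre_digraph \<Rightarrow> 'a \<Rightarrow> 'a \<Rightarrow> 'a pair_pre_digraph" where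
  "add_edge G v w = G\<lparr>parcs := parcs G \<union> {(v, w), (w, v)}\<rparr>"

text \<open>
  Matrices of a graph relative to an enumeration \<open>vs\<close> of its vertices.
\<close>

definition adjacency_mat :: "'a list \<Rightarrow> 'a pair_pre_digraph \<Rightarrow> real mat" where
  "adjacency_mat vs G =
     mat (length vs) (length vs) (\<lambda>(i, j). if (vs ! i, vs ! j) \<in> parcs G then 1 else 0)"

definition degree_mat :: "'a list \<Rightarrow> 'a pair_pre_digraph \<Rightarrow> real mat" where
  "degree_mat vs G =
     mat (length vs) (length vs) (\<lambda>(i, j). if i = j then real (vertex_degree G (vs ! i)) else 0)"

definition laplacian_mat :: "'a list \<Rightarrow> 'a pair_pre_digraph \<Rightarrow> real mat" where
  "laplacian_mat vs G = degree_mat vs G - adjacency_mat vs G"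

definition vertex_enum :: "'a pair_pre_digraph \<Rightarrow> 'a list" where
  "vertex_enum G = (SOME vs. distinct vs \<and> set vs = pverts G)"

text \<open>
  The Laplacian eigenvalues, repeated according to algebraic multiplicity. The enumeration is
  immaterial (lemma \<open>laplacian_spectrum_enum\<close>), and as the Laplacian is a symmetric matrix,
  none of its eigenvalues is lost by taking real roots only (lemma \<open>size_laplacian_spectrum\<close>).
\<close>

definition laplacian_spectrum :: "'a pair_pre_digraph \<Rightarrow> real multiset" where
  "laplacian_spectrum G = proots (char_poly (laplacian_mat (vertex_enum G) G))"

definition laplacian_energy :: "'a pair_pre_digraph \<Rightarrow> real" where
  "laplacian_energy G = (\<Sum>\<mu>\<in>#laplacian_spectrum G. \<bar>\<mu> - average_degree G\<bar>)"

text \<open>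
  \<open>starlike_tree G u h a p\<close>: the vertices of \<open>G\<close> other than the centre \<open>u\<close> are the pairwise distinct
  \<open>p i j\<close> with \<open>1 \<le> i \<le> h\<close> and \<open>1 \<le> j \<le> a i\<close>, and \<open>p i 1, \<dots>, p i (a i)\<close> is the \<open>i\<close>-th
  branch, a path on \<open>a i\<close> vertices whose end \<open>p i 1\<close> is joined to \<open>u\<close>. With the convention
  \<open>p i 0 = u\<close>, the vertex \<open>p i j\<close> is the one at distance \<open>j\<close> from \<open>u\<close> in branch \<open>i\<close>.
\<close>

definition starlike_tree ::
  "'a pair_pre_digraph \<Rightarrow> 'a \<Rightarrow> nat \<Rightarrow> (nat \<Rightarrow> nat) \<Rightarrow> (nat \<Rightarrow> nat \<Rightarrow> 'a) \<Rightarrow> bool" where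
  "starlike_tree G u h a p \<longleftrightarrow>
     (\<forall>i\<in>{1..h}. 1 \<le> a i \<and> p i 0 = u) \<and>
     inj_on (\<lambda>(i, j). p i j) (SIGMA i:{1..h}. {1..a i}) \<and>
     (\<forall>i\<in>{1..h}. \<forall>j\<in>{1..a i}. p i j \<noteq> u) \<and>
     pverts G = insert u {p i j |i j. i \<in> {1..h} \<and> j \<in> {1..a i}} \<and>
     parcs G = {(p i j, p i (Suc j)) |i j. i \<in> {1..h} \<and> j < a i}
             \<union> {(p i (Suc j), p i j) |i j. i \<in> {1..h} \<and> j < a i}"

lemma starlike_tree_verts:
  assumes "starlike_tree G u h a p"
  shows "pverts G = insert u ((\<lambda>(i, j). p i j) ` (SIGMA i:{1..h}. {1..a i}))"
proof -
  have "{p i j |i j. i \<in> {1..h} \<and> j \<in> {1..a i}} = (\<lambda>(i, j). p i j) ` (SIGMA i:{1..h}. {1..a i})"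
    by (force simp del: atLeastAtMost_iff)
  then show ?thesis using assms unfolding starlike_tree_def by metis
qed

lemma starlike_tree_pair_graph:
  assumes "starlike_tree G u h a p" and "1 \<le> h"
  shows "pair_graph G"
proof
  note S = assms(1)[unfolded starlike_tree_def]
  note V = starlike_tree_verts[OF assms(1)]
  have mem: "p i j \<in> pverts G" if "i \<in> {1..h}" "j \<le> a i" for i j
  proof (cases "j = 0")
    case True
    then show ?thesis using S that by auto
  next
    case False
    then have "j \<in> {1..a i}" using that by auto
    then show ?thesis unfolding V using that by force
  qed
  have neq: "p i j \<noteq> p i (Suc j)" if "i \<in> {1..h}" "j < a i" for i j
  proof (cases "j = 0")
    case True
    then show ?thesis using S that by force
  next
    case False
    show ?thesis
    proof
      assume "p i j = p i (Suc j)"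
      with S have "(i, j) = (i, Suc j)"
        using False that by (intro inj_onD[of "\<lambda>(i, j). p i j" _ "(i, j)" "(i, Suc j)"]) auto
      then show False by simp
    qed
  qed
  have E: "parcs G = {(p i j, p i (Suc j)) |i j. i \<in> {1..h} \<and> j < a i}
             \<union> {(p i (Suc j), p i j) |i j. i \<in> {1..h} \<and> j < a i}" using S by blast
  show A: "fst e \<in> pverts G" if "e \<in> parcs G" for e
    using that unfolding E by (auto intro!: mem)
  show B: "snd e \<in> pverts G" if "e \<in> parcs G" for e
    using that unfolding E by (auto intro!: mem)
  show F: "finite (pverts G)" unfolding V by auto
  have "parcs G \<subseteq> pverts G \<times> pverts G" using A B by (metis mem_Times_iff subsetI)
  then show "finite (parcs G)" using F finite_subset by blast
  show "fst e \<noteq> snd e" if "e \<in> parcs G" for e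
    using that neq unfolding E by fastforce
  show "symmetric (with_proj G)"
    unfolding symmetric_def sym_def by (simp, unfold E, blast)
qed

lemma starlike_tree_card:
  assumes "starlike_tree G u h a p"
  shows "card (pverts G) = 1 + (\<Sum>i=1..h. a i)"
proof -
  note S = assms[unfolded starlike_tree_def]
  let ?I = "SIGMA i:{1..h}. {1..a i}" and ?f = "\<lambda>(i, j). p i j"
  note V = starlike_tree_verts[OF assms]
  have "u \<notin> ?f ` ?I" using S by auto
  then have "card (pverts G) = 1 + card (?f ` ?I)" unfolding V by simp
  also have "card (?f ` ?I) = card ?I" using S by (intro card_image) blast
  also have "\<dots> = (\<Sum>i=1..h. a i)" by simp
  finally show ?thesis .
qed

lemma vertex_enum:
  assumes "finite (pverts G)"
  shows "distinct (vertex_enum G)" "set (vertex_enum G) = pverts G"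
    "length (vertex_enum G) = card (pverts G)"
proof -
  have "\<exists>vs. distinct vs \<and> set vs = pverts G" using finite_distinct_list[OF assms] by blast
  from someI_ex[OF this] show *: "distinct (vertex_enum G)" "set (vertex_enum G) = pverts G"
    unfolding vertex_enum_def by auto
  show "length (vertex_enum G) = card (pverts G)" using * distinct_card by metis
qed

lemma laplacian_spectrum_enum:
  assumes "distinct vs" "set vs = pverts G"
  shows "laplacian_spectrum G = proots (char_poly (laplacian_mat vs G))"
proof -
  let ?n = "length vs" and ?ws = "vertex_enum G"
  have fin: "finite (pverts G)" using assms(2) by (metis List.finite_set)
  note ws = vertex_enum[OF fin]
  have len: "length ?ws = ?n" using ws(3) assms distinct_card by metis
  have "\<exists>i<?n. vs ! i = ?ws ! j" if "j < ?n" for j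
    using that assms ws len by (metis in_set_conv_nth)
  then obtain f where f: "\<And>j. j < ?n \<Longrightarrow> f j < ?n \<and> vs ! f j = ?ws ! j" by metis
  have inj: "i = j" if "f i = f j" "i < ?n" "j < ?n" for i j
    using f[of i] f[of j] that ws(1) len by (metis nth_eq_iff_index_eq)
  define P :: "real mat" where "P = mat ?n ?n (\<lambda>(i, j). if j = f i then 1 else 0)"
  define Q :: "real mat" where "Q = mat ?n ?n (\<lambda>(i, j). if i = f j then 1 else 0)"
  let ?A = "laplacian_mat ?ws G" and ?B = "laplacian_mat vs G"
  have carr: "?A \<in> carrier_mat ?n ?n" "?B \<in> carrier_mat ?n ?n"
    "P \<in> carrier_mat ?n ?n" "Q \<in> carrier_mat ?n ?n"
    unfolding laplacian_mat_def adjacency_mat_def degree_mat_def P_def Q_def using len by auto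
  have PQ: "P * Q = 1\<^sub>m ?n"
  proof (rule eq_matI)
    fix i j assume "i < dim_row (1\<^sub>m ?n :: real mat)" "j < dim_col (1\<^sub>m ?n :: real mat)"
    then have ij: "i < ?n" "j < ?n" by auto
    have "(P * Q) $$ (i, j)
      = (\<Sum>k = 0..<?n. (if k = f i then 1 else 0) * (if k = f j then 1 else 0))"
      unfolding P_def Q_def using ij by (simp add: scalar_prod_def)
    also have "\<dots> = (\<Sum>k = 0..<?n. if k = f i then (if f i = f j then 1 else 0) else 0)"
      by (rule sum.cong) auto
    also have "\<dots> = (if f i = f j then 1 else 0)" using f[of i] ij by (simp add: sum.delta)
    also have "\<dots> = (1\<^sub>m ?n :: real mat) $$ (i, j)" using ij inj by auto
    finally show "(P * Q) $$ (i, j) = (1\<^sub>m ?n :: real mat) $$ (i, j)" .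
  qed (use carr in auto)
  have QP: "Q * P = 1\<^sub>m ?n" using mat_mult_left_right_inverse[OF carr(3,4) PQ] .
  have PB: "P * ?B = mat ?n ?n (\<lambda>(i, j). ?B $$ (f i, j))"
  proof (rule eq_matI)
    fix i j assume "i < dim_row (mat ?n ?n (\<lambda>(i, j). ?B $$ (f i, j)))"
      "j < dim_col (mat ?n ?n (\<lambda>(i, j). ?B $$ (f i, j)))"
    then have ij: "i < ?n" "j < ?n" by auto
    have "(P * ?B) $$ (i, j) = (\<Sum>k = 0..<?n. (if k = f i then 1 else 0) * ?B $$ (k, j))"
      unfolding P_def using ij carr(2) by (auto simp: scalar_prod_def)
    also have "\<dots> = (\<Sum>k = 0..<?n. if k = f i then ?B $$ (f i, j) else 0)"
      by (rule sum.cong) auto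
    also have "\<dots> = ?B $$ (f i, j)" using f[of i] ij by (simp add: sum.delta)
    finally show "(P * ?B) $$ (i, j) = mat ?n ?n (\<lambda>(i, j). ?B $$ (f i, j)) $$ (i, j)"
      using ij by simp
  qed (use carr in auto)
  have "P * ?B * Q = mat ?n ?n (\<lambda>(i, j). ?B $$ (f i, f j))" unfolding PB
  proof (rule eq_matI)
    fix i j assume "i < dim_row (mat ?n ?n (\<lambda>(i, j). ?B $$ (f i, f j)))"
      "j < dim_col (mat ?n ?n (\<lambda>(i, j). ?B $$ (f i, f j)))"
    then have ij: "i < ?n" "j < ?n" by auto
    have "(mat ?n ?n (\<lambda>(i, j). ?B $$ (f i, j)) * Q) $$ (i, j)
      = (\<Sum>k = 0..<?n. ?B $$ (f i, k) * (if k = f j then 1 else 0))"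
      unfolding Q_def using ij by (auto simp: scalar_prod_def)
    also have "\<dots> = (\<Sum>k = 0..<?n. if k = f j then ?B $$ (f i, f j) else 0)"
      by (rule sum.cong) auto
    also have "\<dots> = ?B $$ (f i, f j)" using f[of j] ij by (simp add: sum.delta)
    finally show "(mat ?n ?n (\<lambda>(i, j). ?B $$ (f i, j)) * Q) $$ (i, j)
      = mat ?n ?n (\<lambda>(i, j). ?B $$ (f i, f j)) $$ (i, j)"
      using ij by simp
  qed (use carr in auto)
  also have "\<dots> = ?A"
    by (rule eq_matI)
      (use f inj len in \<open>auto simp: laplacian_mat_def adjacency_mat_def degree_mat_def\<close>)
  finally have "similar_mat ?A ?B"
    using carr PQ QP by (intro similar_matI[of _ _ P Q ?n]) auto
  then show ?thesis unfolding laplacian_spectrum_def by (simp add: char_poly_similar)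
qed

lemma eigenvalue_symmetric_real:
  fixes A :: "real mat"
  assumes A: "A \<in> carrier_mat n n" and sym: "\<And>i j. i < n \<Longrightarrow> j < n \<Longrightarrow> A $$ (i, j) = A $$ (j, i)"
    and ev: "eigenvalue (map_mat complex_of_real A) z"
  shows "z \<in> \<real>"
proof -
  let ?C = "map_mat complex_of_real A"
  have C: "?C \<in> carrier_mat n n" using A by auto
  obtain v where v: "v \<in> carrier_vec n" "v \<noteq> 0\<^sub>v n" "?C *\<^sub>v v = z \<cdot>\<^sub>v v"
    using ev C unfolding eigenvalue_def eigenvector_def by auto
  have row: "(\<Sum>j<n. complex_of_real (A $$ (i, j)) * v $ j) = z * v $ i" if "i < n" for i
  proof -
    have "(?C *\<^sub>v v) $ i = (\<Sum>j<n. complex_of_real (A $$ (i, j)) * v $ j)"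
      using that A v(1) by (auto simp: scalar_prod_def lessThan_atLeast0 intro!: sum.cong)
    then show ?thesis using v that by auto
  qed
  define N where "N = (\<Sum>i<n. (cmod (v $ i))\<^sup>2)"
  define q where "q = (\<Sum>i<n. \<Sum>j<n. cnj (v $ i) * (complex_of_real (A $$ (i, j)) * v $ j))"
  have "q = (\<Sum>i<n. cnj (v $ i) * (z * v $ i))"
    unfolding q_def sum_distrib_left[symmetric] by (intro sum.cong) (auto simp: row)
  also have "\<dots> = (\<Sum>i<n. z * (v $ i * cnj (v $ i)))"
    by (simp add: ac_simps)
  also have "\<dots> = z * of_real N"
    unfolding N_def of_real_sum sum_distrib_left complex_norm_square ..
  finally have q: "q = z * of_real N" .
  have "cnj q = (\<Sum>i<n. \<Sum>j<n. v $ i * (complex_of_real (A $$ (i, j)) * cnj (v $ j)))"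
    unfolding q_def by (simp add: cnj_sum)
  also have "\<dots> = (\<Sum>j<n. \<Sum>i<n. v $ i * (complex_of_real (A $$ (i, j)) * cnj (v $ j)))"
    by (rule sum.swap)
  also have "\<dots> = q" unfolding q_def
    by (intro sum.cong) (auto simp: sym)
  finally have "cnj z * of_real N = z * of_real N" unfolding q by simp
  moreover have "N \<noteq> 0"
  proof
    assume "N = 0"
    then have "\<forall>i<n. v $ i = 0" unfolding N_def by (subst (asm) sum_nonneg_eq_0_iff) auto
    then have "v = 0\<^sub>v n" using v(1) by (intro eq_vecI) auto
    with v(2) show False ..
  qed
  ultimately have "cnj z = z" by simp
  then show ?thesis using Reals_cnj_iff by blast
qed

lemma size_laplacian_spectrum:
  assumes "pair_graph G"
  shows "size (laplacian_spectrum G) = card (pverts G)"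
proof -
  interpret pair_graph G by fact
  let ?vs = "vertex_enum G" and ?n = "card (pverts G)"
  let ?L = "laplacian_mat ?vs G"
  have L: "?L \<in> carrier_mat ?n ?n"
    unfolding laplacian_mat_def adjacency_mat_def degree_mat_def
    using vertex_enum(3)[OF pair_finite_verts] by auto
  have sym: "?L $$ (i, j) = ?L $$ (j, i)" if "i < ?n" "j < ?n" for i j
    using that vertex_enum(3)[OF pair_finite_verts] arcs_ends_symmetric[OF pair_sym_arcs]
    by (auto simp: laplacian_mat_def adjacency_mat_def degree_mat_def)
  let ?C = "map_mat complex_of_real ?L"
  have C: "?C \<in> carrier_mat ?n ?n" using L by auto
  obtain as where as: "char_poly ?C = (\<Prod>a\<leftarrow>as. [:- a, 1:])" "length as = ?n"
    using char_poly_factorized[OF C] by blast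
  have re: "complex_of_real (Re a) = a" if "a \<in> set as" for a
  proof -
    have "poly (char_poly ?C) a = 0"
      unfolding as(1) poly_prod_list using that by (force simp: prod_list_zero_iff)
    then have "eigenvalue ?C a" using eigenvalue_root_char_poly[OF C] by simp
    from eigenvalue_symmetric_real[OF L sym this] show ?thesis by simp
  qed
  interpret hp: map_poly_inj_comm_ring_hom complex_of_real ..
  have "map_poly complex_of_real (char_poly ?L) = char_poly ?C"
    by (rule of_real_hom.char_poly_hom[OF L, symmetric])
  also have "\<dots> = map_poly complex_of_real (\<Prod>a\<leftarrow>as. [:- Re a, 1:])"
    unfolding as(1) hp.hom_prod_list map_map
    by (rule arg_cong[of _ _ prod_list], rule map_cong) (auto simp: re map_poly_pCons)
  finally have eq: "char_poly ?L = (\<Prod>a\<leftarrow>as. [:- Re a, 1:])" by simp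
  have "size (proots (\<Prod>a\<leftarrow>bs. [:- Re a, 1:])) = length bs" for bs
  proof (induction bs)
    case (Cons b bs)
    have "(\<Prod>a\<leftarrow>bs. [:- Re a, 1:]) \<noteq> 0" by (auto simp: prod_list_zero_iff)
    with Cons show ?case by (simp add: proots_mult del: mult_pCons_left)
  qed simp
  then show ?thesis unfolding laplacian_spectrum_def eq as(2)[symmetric] .
qed

end

theory Submission
  imports Defs "HOL-Analysis.Convex" "HOL-Combinatorics.Transposition"
begin

text \<open>
  Here \<open>n\<close> is even, \<open>G\<close> has average degree \<open>2 - 2 / n\<close> and \<open>G'\<close> has average degree \<open>2\<close>. Two facts
  combine. First, exactly half of the eigenvalues of \<open>G\<close> are at most \<open>2 - 2 / n\<close> and the other half
  are at least \<open>2\<close>, so \<open>\<Sum>\<bar>\<mu> - t\<bar>\<close> is the same for \<open>t = 2 - 2 / n\<close> and \<open>t = 2\<close>; both counts come from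
  bounding the quadratic form on the common zeros of \<open>n / 2\<close> linear functionals. Second, permuting
  rows and columns of \<open>L - 2\<close> by two commuting involutions whose product is an automorphism of \<open>G\<close>
  gives \<open>L' - 2\<close>; hence \<open>(L - 2)\<^sup>2\<close> and \<open>(L' - 2)\<^sup>2\<close> are similar and \<open>\<Sum>\<bar>\<mu> - 2\<bar>\<close> is the same for both
  graphs.
\<close>

section \<open>Real symmetric matrices\<close>

text \<open>\<open>L - 2\<close> and \<open>L' - 2\<close> have traces -2 and 0, so they are never
  similar; this is why only their squares are compared, and it suffices because \<bar>\<mu> -
  2\<bar> does not see the sign. The shift 2 is the average degree of \<open>G'\<close> and also the
  degree of an inner path vertex: subtracting it clears the diagonal there, leaves -1 at the leaves,
  and the new edge merely moves two of these entries off the diagonal. The eigenvalue-free interval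
  between 2 - 2 / n and 2 is where the remaining hypotheses enter. The parities of the branch
  lengths give the tree a perfect matching, and its n / 2 edges yield the functionals for the upper
  half. For the lower half, with \<epsilon> = 2 / n, an even branch of length a needs \<epsilon> (a
  + 2) \<le> 2, which holds since the centre and the odd branch lie outside it; the odd branch needs
  \<epsilon> (a_h + 1) \<le> 1, which for even n is the assumption a_h < n / 2.\<close>

definition indexed_mat :: "'b list \<Rightarrow> ('b \<Rightarrow> 'b \<Rightarrow> 'c) \<Rightarrow> 'c mat" where
  "indexed_mat xs E = mat (length xs) (length xs) (\<lambda>(i, j). E (xs ! i) (xs ! j))"

lemma indexed_mat_carrier [simp]: "indexed_mat xs E \<in> carrier_mat (length xs) (length xs)"
  and dim_indexed_mat [simp]: "dim_row (indexed_mat xs E) = length xs"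
    "dim_col (indexed_mat xs E) = length xs"
  and index_indexed_mat [simp]: "i < length xs \<Longrightarrow> j < length xs \<Longrightarrow>
    indexed_mat xs E $$ (i, j) = E (xs ! i) (xs ! j)"
  by (auto simp: indexed_mat_def)

lemma sum_nth_distinct:
  assumes "distinct xs"
  shows "(\<Sum>i<length xs. g (xs ! i)) = (\<Sum>x\<in>set xs. g x)"
proof -
  have "bij_betw ((!) xs) {..<length xs} (set xs)"
    using assms by (intro bij_betw_nth) auto
  then show ?thesis by (rule sum.reindex_bij_betw)
qed

text \<open>A change of enumeration is a similarity by a permutation matrix. As entries depend on
  labels and not on positions, permuting rows and columns simultaneously is just listing the labels
  in another order.\<close>

lemma char_poly_indexed_mat:
  fixes E :: "'b \<Rightarrow> 'b \<Rightarrow> 'c::field"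
  assumes "distinct xs" "distinct ys" "set xs = set ys"
  shows "char_poly (indexed_mat xs E) = char_poly (indexed_mat ys E)"
proof -
  let ?n = "length xs"
  have len: "length ys = ?n" using assms by (metis distinct_card)
  define P :: "'c mat" where "P = mat ?n ?n (\<lambda>(i, j). if xs ! i = ys ! j then 1 else 0)"
  define Q :: "'c mat" where "Q = mat ?n ?n (\<lambda>(i, j). if ys ! i = xs ! j then 1 else 0)"
  have carr: "P \<in> carrier_mat ?n ?n" "Q \<in> carrier_mat ?n ?n" by (auto simp: P_def Q_def)
  have mem: "xs ! i \<in> set ys" "ys ! i \<in> set xs" if "i < ?n" for i
    using that assms len by (metis nth_mem)+
  have delta: "(\<Sum>k<?n. (if s = ys ! k then 1 else 0) * g (ys ! k)) = g s"
    "(\<Sum>k<?n. g (ys ! k) * (if ys ! k = s then 1 else 0)) = g s"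
    if "s \<in> set xs" for s and g :: "'b \<Rightarrow> 'c"
    using that assms(3) sum_nth_distinct[OF assms(2), of "\<lambda>t. (if s = t then 1 else 0) * g t"]
      sum_nth_distinct[OF assms(2), of "\<lambda>t. g t * (if t = s then 1 else 0)"]
    by (simp_all add: len if_distrib if_distribR sum.delta sum.delta' cong: if_cong)
  have PQ: "P * Q = 1\<^sub>m ?n"
  proof (rule eq_matI)
    fix i j assume "i < dim_row (1\<^sub>m ?n :: 'c mat)" "j < dim_col (1\<^sub>m ?n :: 'c mat)"
    then show "(P * Q) $$ (i, j) = 1\<^sub>m ?n $$ (i, j)"
      using delta(1)[of "xs ! i" "\<lambda>t. if t = xs ! j then 1 else 0"] assms(1)
      by (auto simp: P_def Q_def scalar_prod_def lessThan_atLeast0[symmetric] nth_eq_iff_index_eq)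
  qed (auto simp: P_def Q_def)
  have PE: "P * indexed_mat ys E = mat ?n ?n (\<lambda>(i, j). E (xs ! i) (ys ! j))"
  proof (rule eq_matI)
    fix i j assume "i < dim_row (mat ?n ?n (\<lambda>(i, j). E (xs ! i) (ys ! j)))"
      "j < dim_col (mat ?n ?n (\<lambda>(i, j). E (xs ! i) (ys ! j)))"
    then show "(P * indexed_mat ys E) $$ (i, j)
        = mat ?n ?n (\<lambda>(i, j). E (xs ! i) (ys ! j)) $$ (i, j)"
      using delta(1)[of "xs ! i" "\<lambda>t. E t (ys ! j)"] len
      by (auto simp: P_def scalar_prod_def lessThan_atLeast0[symmetric])
  qed (auto simp: P_def len)
  have "P * indexed_mat ys E * Q = indexed_mat xs E" unfolding PE
  proof (rule eq_matI)
    fix i j assume "i < dim_row (indexed_mat xs E)" "j < dim_col (indexed_mat xs E)"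
    then show "(mat ?n ?n (\<lambda>(i, j). E (xs ! i) (ys ! j)) * Q) $$ (i, j)
        = indexed_mat xs E $$ (i, j)"
      using delta(2)[of "xs ! j" "\<lambda>t. E (xs ! i) t"]
      by (auto simp: Q_def scalar_prod_def lessThan_atLeast0[symmetric])
  qed (auto simp: Q_def)
  moreover have "Q * P = 1\<^sub>m ?n" using mat_mult_left_right_inverse[OF carr PQ] .
  ultimately have "similar_mat (indexed_mat xs E) (indexed_mat ys E)"
    using carr PQ indexed_mat_carrier[of ys E] len
    by (intro similar_matI[of _ _ P Q ?n]) auto
  then show ?thesis by (rule char_poly_similar)
qed

text \<open>Gaussian elimination: an equation with zero coefficients is dropped, any other one is
  used to eliminate an unknown. Later the unknowns are coefficients of eigenvectors and the
  equations are vanishing functionals.\<close>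

lemma homogeneous_system_nontrivial:
  fixes M :: "'k \<Rightarrow> 'r \<Rightarrow> 'a::field"
  assumes "finite K" "finite R" "card K < card R"
  shows "\<exists>\<alpha>. (\<exists>r\<in>R. \<alpha> r \<noteq> 0) \<and> (\<forall>k\<in>K. (\<Sum>r\<in>R. M k r * \<alpha> r) = 0)"
  using assms
proof (induction K arbitrary: R M rule: finite_induct)
  case empty
  then have "R \<noteq> {}" by auto
  then show ?case by (intro exI[of _ "\<lambda>_. 1"]) auto
next
  case (insert k K)
  show ?case
  proof (cases "\<forall>r\<in>R. M k r = 0")
    case True
    then show ?thesis using insert.IH[of R M] insert.prems insert.hyps by auto
  next
    case False
    then obtain q where q: "q \<in> R" "M k q \<noteq> 0" by auto
    let ?R = "R - {q}"
    have "card K < card ?R" using insert.prems insert.hyps q by simp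
    then obtain \<alpha> where \<alpha>: "\<exists>r\<in>?R. \<alpha> r \<noteq> 0"
      "\<And>l. l \<in> K \<Longrightarrow> (\<Sum>r\<in>?R. (M l r - M l q / M k q * M k r) * \<alpha> r) = 0"
      using insert.IH[of ?R "\<lambda>l r. M l r - M l q / M k q * M k r"] insert.prems by auto
    \<comment> \<open>The pivot unknown gets the value that makes equation \<open>k\<close> hold;
      substituting it into another equation gives the reduced equation that \<alpha> solves.\<close>
    define \<beta> where "\<beta> = \<alpha>(q := - (\<Sum>r\<in>?R. M k r * \<alpha> r) / M k q)"
    have eq: "(\<Sum>r\<in>R. M l r * \<beta> r)
        = (\<Sum>r\<in>?R. M l r * \<alpha> r) - M l q / M k q * (\<Sum>r\<in>?R. M k r * \<alpha> r)" for l
      using insert.prems(1) q(1) unfolding \<beta>_def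
      by (subst sum.remove[of R q]) (auto intro!: sum.cong)
    have "(\<Sum>r\<in>R. M l r * \<beta> r) = 0" if "l \<in> insert k K" for l
      using that \<alpha>(2)[of l] q(2)
      by (auto simp: eq left_diff_distrib sum_subtractf sum_distrib_left mult.assoc)
    moreover have "\<exists>r\<in>R. \<beta> r \<noteq> 0" using \<alpha>(1) by (auto simp: \<beta>_def)
    ultimately show ?thesis by blast
  qed
qed

section \<open>Spectral theorem for real symmetric matrices\<close>

lemma symmetric_mat_eigenvalue_exists:
  fixes A :: "real mat"
  assumes A: "A \<in> carrier_mat n n" and sym: "transpose_mat A = A" and n: "0 < n"
  shows "\<exists>e. eigenvalue A e"
proof -
  let ?C = "map_mat complex_of_real A"
  have C: "?C \<in> carrier_mat n n" using A by auto
  have "degree (char_poly ?C) = n" using degree_monic_char_poly[OF C] by simp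
  then obtain z where z: "poly (char_poly ?C) z = 0"
    using fundamental_theorem_of_algebra[of "char_poly ?C"] n
    by (auto simp: constant_degree)
  have "A $$ (i, j) = A $$ (j, i)" if "i < n" "j < n" for i j
    using that A sym by (metis carrier_matD index_transpose_mat(1))
  then have "z \<in> \<real>"
    using eigenvalue_symmetric_real[OF A, of z] z eigenvalue_root_char_poly[OF C] by blast
  then obtain e where "z = complex_of_real e" by (auto elim: Reals_cases)
  then have "poly (char_poly A) e = 0"
    using z by (simp add: of_real_hom.char_poly_hom[OF A] of_real_hom.poly_map_poly)
  then show ?thesis using eigenvalue_root_char_poly[OF A] by blast
qed

text \<open>Reflection in the hyperplane orthogonal to z = e_0 - v exchanges the unit vectors e_0
  and v. The sign condition keeps z away from 0.\<close>

lemma householder_reflection: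
  fixes v :: "real vec"
  assumes v: "v \<in> carrier_vec n" "v \<bullet> v = 1" and n: "0 < n" and le: "v $ 0 \<le> 0"
  shows "\<exists>U\<in>carrier_mat n n. transpose_mat U = U \<and> U * U = 1\<^sub>m n \<and> U *\<^sub>v unit_vec n 0 = v"
proof -
  \<comment> \<open>This is 2 / |z|^2, since |z|^2 = 2 - 2 * v_0 for a unit vector v.\<close>
  define c where "c = 1 / (1 - v $ 0)"
  define z where "z i = (if i = 0 then 1 else 0) - v $ i" for i
  define U where "U = mat n n (\<lambda>(i, j). (if i = j then 1 else 0) - c * z i * z j)"
  have nz: "1 - v $ 0 \<noteq> 0" using le by simp
  have U: "U \<in> carrier_mat n n" by (simp add: U_def)
  have "(\<Sum>i<n. (v $ i)\<^sup>2) = 1"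
    using v by (simp add: scalar_prod_def lessThan_atLeast0 power2_eq_square)
  moreover have "(z i)\<^sup>2 = (if i = 0 then 1 - 2 * v $ 0 else 0) + (v $ i)\<^sup>2" for i
    by (simp add: z_def power2_eq_square algebra_simps)
  ultimately have "(\<Sum>i<n. (z i)\<^sup>2) = 2 - 2 * v $ 0"
    using n by (simp add: sum.distrib sum.delta)
  then have zz: "c * (\<Sum>i<n. z i * z i) = 2"
    using nz by (simp add: c_def power2_eq_square field_simps)
  have "transpose_mat U = U" by (rule eq_matI) (auto simp: U_def)
  moreover have "U * U = 1\<^sub>m n"
  proof (rule eq_matI)
    fix i j assume "i < dim_row (1\<^sub>m n :: real mat)" "j < dim_col (1\<^sub>m n :: real mat)"
    then have ij: "i < n" "j < n" by auto
    have "(U * U) $$ (i, j) = (\<Sum>k<n. ((if i = k then 1 else 0) - c * z i * z k)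
        * ((if k = j then 1 else 0) - c * z k * z j))"
      using ij by (simp add: U_def scalar_prod_def lessThan_atLeast0)
    also have "\<dots> = (\<Sum>k<n. (if k = i then (if i = j then 1 else 0) - c * z i * z j else 0)
        - (if k = j then c * z i * z j else 0) + c * z i * z j * (c * (z k * z k)))"
      by (rule sum.cong) (auto simp: algebra_simps)
    also have "\<dots> = (if i = j then 1 else 0) - 2 * (c * z i * z j)
        + c * z i * z j * (c * (\<Sum>k<n. z k * z k))"
      using ij by (simp add: sum.distrib sum_subtractf sum_distrib_left)
    finally show "(U * U) $$ (i, j) = 1\<^sub>m n $$ (i, j)" using ij by (simp add: zz)
  qed (simp_all add: U_def)
  moreover have "U *\<^sub>v unit_vec n 0 = v"
  proof (rule eq_vecI)
    fix i assume "i < dim_vec v"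
    then have i: "i < n" using v by simp
    have "(U *\<^sub>v unit_vec n 0) $ i = U $$ (i, 0)"
      using i n U by (simp add: mult_mat_vec_def)
    also have "\<dots> = (if i = 0 then 1 else 0) - c * z i * z 0" using i n by (simp add: U_def)
    also have "c * z i * z 0 = z i" using nz by (simp add: c_def z_def)
    finally show "(U *\<^sub>v unit_vec n 0) $ i = v $ i" by (simp add: z_def)
  qed (use U v in simp)
  ultimately show ?thesis using U by blast
qed

text \<open>Deflation: conjugating by a reflection that takes e_0 to a unit eigenvector makes the
  first column a multiple of e_0, symmetry then clears the first row, and induction treats the
  remaining block.\<close>

theorem symmetric_mat_diagonalizable:
  fixes A :: "real mat"
  assumes "A \<in> carrier_mat n n" "transpose_mat A = A"
  shows "\<exists>W\<in>carrier_mat n n. \<exists>f. transpose_mat W * W = 1\<^sub>m n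
    \<and> A * W = W * mat_diag n f"
  using assms
proof (induction n arbitrary: A)
  case 0
  then show ?case by (intro bexI[of _ "1\<^sub>m 0"] exI[of _ "\<lambda>_. 0"]) (auto intro!: eq_matI simp: mat_diag_def)
next
  case (Suc n A)
  note A = Suc.prems
  obtain e where "eigenvalue A e" using symmetric_mat_eigenvalue_exists[OF A] by auto
  then obtain v where v: "v \<in> carrier_vec (Suc n)" "v \<noteq> 0\<^sub>v (Suc n)" "A *\<^sub>v v = e \<cdot>\<^sub>v v"
    using A unfolding eigenvalue_def eigenvector_def by auto
  have pos: "0 < v \<bullet> v"
    using conjugate_square_greater_0_vec[OF v(1)] v(2) by simp
  \<comment> \<open>The sign of a unit eigenvector is free; it is chosen to make the first entry
    nonpositive, as \<open>householder_reflection\<close> requires.\<close>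
  define b where "b = (if v $ 0 \<le> 0 then 1 / sqrt (v \<bullet> v) else - 1 / sqrt (v \<bullet> v))"
  define w where "w = b \<cdot>\<^sub>v v"
  have w: "w \<in> carrier_vec (Suc n)" "w \<bullet> w = 1" "w $ 0 \<le> 0" "A *\<^sub>v w = e \<cdot>\<^sub>v w"
  proof -
    show "w \<in> carrier_vec (Suc n)" using v by (simp add: w_def)
    have "b * b * (v \<bullet> v) = 1" using pos by (simp add: b_def)
    then show "w \<bullet> w = 1" using v by (simp add: w_def)
    show "w $ 0 \<le> 0" using v pos by (simp add: w_def b_def divide_nonpos_pos)
    show "A *\<^sub>v w = e \<cdot>\<^sub>v w" using v A by (simp add: w_def mult_mat_vec smult_smult_assoc mult.commute)
  qed
  obtain U where U: "U \<in> carrier_mat (Suc n) (Suc n)" "transpose_mat U = U"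
    "U * U = 1\<^sub>m (Suc n)" "U *\<^sub>v unit_vec (Suc n) 0 = w"
    using householder_reflection[OF w(1,2) _ w(3)] by auto
  define A' where "A' = U * A * U"
  have A': "A' \<in> carrier_mat (Suc n) (Suc n)" using A U by (simp add: A'_def)
  have symA': "transpose_mat A' = A'"
  proof -
    have "transpose_mat (U * A * U) = U * (A * U)"
      using A U by (subst transpose_mult[of _ "Suc n" "Suc n"]) (auto simp: transpose_mult[of _ "Suc n" "Suc n"])
    then show ?thesis using A U by (simp add: A'_def)
  qed
  have "A' *\<^sub>v unit_vec (Suc n) 0 = U *\<^sub>v (A *\<^sub>v w)"
    using A U unfolding A'_def
    by (metis assoc_mult_mat_vec mult_carrier_mat mult_mat_vec_carrier unit_vec_carrier)
  also have "\<dots> = e \<cdot>\<^sub>v (U *\<^sub>v (U *\<^sub>v unit_vec (Suc n) 0))" 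
    using U w by (simp add: mult_mat_vec)
  also have "U *\<^sub>v (U *\<^sub>v unit_vec (Suc n) 0) = unit_vec (Suc n) 0"
    using U by (metis assoc_mult_mat_vec one_mult_mat_vec unit_vec_carrier)
  finally have col: "A' *\<^sub>v unit_vec (Suc n) 0 = e \<cdot>\<^sub>v unit_vec (Suc n) 0" .
  have col0: "A' $$ (i, 0) = (if i = 0 then e else 0)" if "i < Suc n" for i
    using arg_cong[OF col, of "\<lambda>x. x $ i"] that A' by (simp add: mult_mat_vec_def)
  have row0: "A' $$ (0, i) = (if i = 0 then e else 0)" if "i < Suc n" for i
    using col0[OF that] that A' symA' by (metis carrier_matD index_transpose_mat(1) zero_less_Suc)
  define B where "B = mat n n (\<lambda>(i, j). A' $$ (Suc i, Suc j))"
  have B: "B \<in> carrier_mat n n" by (simp add: B_def)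
  have "A' $$ (i, j) = A' $$ (j, i)" if "i < Suc n" "j < Suc n" for i j
    using that A' symA' by (metis carrier_matD index_transpose_mat(1))
  then have symB: "transpose_mat B = B" by (intro eq_matI) (auto simp: B_def)
  let ?bl = "\<lambda>d X. four_block_mat (mat 1 1 (\<lambda>_. d)) (0\<^sub>m 1 n) (0\<^sub>m n 1) X"
  have A'_block: "A' = ?bl e B"
    using A' col0 row0 by (intro eq_matI) (auto simp: B_def)
  obtain V f where V: "V \<in> carrier_mat n n" "transpose_mat V * V = 1\<^sub>m n"
    and f: "B * V = V * mat_diag n f"
    using Suc.IH[OF B symB] by auto
  let ?V = "?bl 1 V"
  define g where "g i = (case i of 0 \<Rightarrow> e | Suc j \<Rightarrow> f j)" for i
  have diag: "mat_diag (Suc n) g = ?bl e (mat_diag n f)"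
    by (intro eq_matI) (auto simp: mat_diag_def g_def split: nat.split)
  have one: "1\<^sub>m (Suc n) = ?bl (1::real) (1\<^sub>m n)"
    by (intro eq_matI) auto
  have Vc: "?V \<in> carrier_mat (Suc n) (Suc n)" using V by auto
  have mult11: "mat 1 1 (\<lambda>_. x) * mat 1 1 (\<lambda>_. y) = mat 1 1 (\<lambda>_. x * y)" for x y :: real
    by (intro eq_matI) (auto simp: scalar_prod_def)
  have mult_bl: "?bl x X * ?bl y Y = ?bl (x * y) (X * Y)"
    if "X \<in> carrier_mat n n" "Y \<in> carrier_mat n n" for x y :: real and X Y
    using that by (subst mult_four_block_mat[of _ 1 1 _ n _ n _ _ 1 _ n]) (auto simp: mult11[unfolded One_nat_def])
  have tV: "transpose_mat ?V = ?bl 1 (transpose_mat V)"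
    using V by (subst transpose_four_block_mat[of _ 1 1 _ n _ n]) (auto intro!: cong_four_block_mat eq_matI)
  have orthV: "transpose_mat ?V * ?V = 1\<^sub>m (Suc n)"
    unfolding tV one using V by (subst mult_bl) auto
  have A'V: "A' * ?V = ?V * mat_diag (Suc n) g"
    unfolding A'_block diag using V B by (subst (1 2) mult_bl) (auto simp: f mult.commute)
  let ?N = "Suc n"
  let ?W = "U * ?V"
  have W: "?W \<in> carrier_mat ?N ?N" using U Vc by auto
  have UU: "U * (U * X) = X" if "X \<in> carrier_mat ?N ?N" for X
    using U that by (metis assoc_mult_mat left_mult_one_mat)
  have "transpose_mat ?W * ?W = transpose_mat ?V * U * (U * ?V)"
    using U Vc by (simp add: transpose_mult[of _ ?N ?N])
  also have "\<dots> = transpose_mat ?V * (U * (U * ?V))"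
    using U Vc by (intro assoc_mult_mat[of _ ?N ?N _ ?N _ ?N]) auto
  finally have orthW: "transpose_mat ?W * ?W = 1\<^sub>m ?N" using UU[OF Vc] orthV by simp
  have "A * ?W = U * (U * (A * ?W))" using UU[of "A * ?W"] A W by simp
  also have "\<dots> = U * (A' * ?V)"
    using A U Vc by (simp add: A'_def assoc_mult_mat[of _ ?N ?N _ ?N _ ?N] del: U(3))
  also have "\<dots> = ?W * mat_diag ?N g"
    unfolding A'V using U Vc by (intro assoc_mult_mat[of _ ?N ?N _ ?N _ ?N, symmetric]) auto
  finally show ?case using W orthW by blast
qed

section \<open>Spectra from eigenbases, and eigenvalue counts\<close>

lemma proots_prod_list_linear:
  "proots (\<Prod>b\<leftarrow>bs. [:- b, 1:]) = mset (bs :: real list)"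
proof (induction bs)
  case (Cons b bs)
  have "(\<Prod>b\<leftarrow>bs. [:- b, 1:]) \<noteq> 0" by (auto simp: prod_list_zero_iff)
  with Cons show ?case by (simp add: proots_mult del: mult_pCons_left)
qed simp

text \<open>The bridge from eigenvectors to algebraic multiplicities: as many orthonormal
  eigenvectors as the dimension form an orthogonal matrix, which conjugates the given matrix to a
  diagonal one.\<close>

lemma proots_char_poly_orthonormal_eigenvectors:
  fixes E :: "'b \<Rightarrow> 'b \<Rightarrow> real"
  assumes xs: "distinct xs" "length xs = n"
    and orth: "\<And>r s. r < n \<Longrightarrow> s < n \<Longrightarrow>
      (\<Sum>v\<in>set xs. w r v * w s v) = (if r = s then 1 else 0)"
    and eig: "\<And>r v. r < n \<Longrightarrow> v \<in> set xs \<Longrightarrow> (\<Sum>t\<in>set xs. E v t * w r t) = f r * w r v"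
  shows "proots (char_poly (indexed_mat xs E)) = mset (map f [0..<n])"
proof -
  let ?A = "indexed_mat xs E"
  have A: "?A \<in> carrier_mat n n" using indexed_mat_carrier[of xs E] xs(2) by simp
  define W where "W = mat n n (\<lambda>(i, r). w r (xs ! i))"
  have W: "W \<in> carrier_mat n n" by (simp add: W_def)
  have WW: "transpose_mat W * W = 1\<^sub>m n"
    using orth
    by (intro eq_matI) (simp_all add: W_def scalar_prod_def lessThan_atLeast0[symmetric]
        sum_nth_distinct[OF xs(1), unfolded xs(2), of "\<lambda>v. w i v * w j v" for i j])
  have AW: "?A * W = W * mat_diag n f"
    using eig xs(2)
    by (intro eq_matI) (simp_all add: W_def mat_diag_mult_right[of _ n n] scalar_prod_def
        lessThan_atLeast0[symmetric] mult.commute[of "w j v" "f j" for j v]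
        sum_nth_distinct[OF xs(1), unfolded xs(2), of "\<lambda>v. E (xs ! i) v * w j v" for i j])
  have tW: "transpose_mat W \<in> carrier_mat n n" using W by simp
  have WW': "W * transpose_mat W = 1\<^sub>m n" using mat_mult_left_right_inverse[OF tW W WW] .
  have "W * mat_diag n f * transpose_mat W = ?A * (W * transpose_mat W)"
    unfolding AW[symmetric] by (rule assoc_mult_mat[OF A W tW])
  then have "?A = W * mat_diag n f * transpose_mat W" using WW' right_mult_one_mat[OF A] by simp
  then have "similar_mat ?A (mat_diag n f)"
    using A W tW WW WW' by (intro similar_matI[of _ _ W "transpose_mat W" n]) auto
  then have "char_poly ?A = char_poly (mat_diag n f)" by (rule char_poly_similar)
  also have "\<dots> = (\<Prod>b\<leftarrow>diag_mat (mat_diag n f). [:- b, 1:])"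
    by (rule char_poly_upper_triangular[of _ n]) (auto simp: mat_diag_def)
  also have "diag_mat (mat_diag n f) = map f [0..<n]"
    by (auto simp: diag_mat_def mat_diag_def)
  finally show ?thesis by (simp only: proots_prod_list_linear)
qed

lemma orthonormal_eigenvectors_exist:
  fixes E :: "'b \<Rightarrow> 'b \<Rightarrow> real"
  assumes xs: "distinct xs" "length xs = n"
    and sym: "\<And>v t. v \<in> set xs \<Longrightarrow> t \<in> set xs \<Longrightarrow> E v t = E t v"
  obtains w f where
    "\<And>r s. r < n \<Longrightarrow> s < n \<Longrightarrow> (\<Sum>v\<in>set xs. w r v * w s v) = (if r = s then 1 else 0 :: real)"
    "\<And>r v. r < n \<Longrightarrow> v \<in> set xs \<Longrightarrow> (\<Sum>t\<in>set xs. E v t * w r t) = f r * w r v"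
proof -
  let ?A = "indexed_mat xs E"
  have A: "?A \<in> carrier_mat n n" using indexed_mat_carrier[of xs E] xs(2) by simp
  have "transpose_mat ?A = ?A" using sym by (intro eq_matI) auto
  then obtain W f where W: "W \<in> carrier_mat n n" "transpose_mat W * W = 1\<^sub>m n"
    and AW: "?A * W = W * mat_diag n f"
    using symmetric_mat_diagonalizable[OF A] by auto
  \<comment> \<open>Columns become functions of the labels: a label is sent back to its unique
    position in \<open>xs\<close>.\<close>
  define w where "w r v = W $$ (inv_into {..<n} ((!) xs) v, r)" for r v
  have inj: "inj_on ((!) xs) {..<n}" using xs by (auto simp: inj_on_nth)
  have w: "w r (xs ! i) = W $$ (i, r)" if "i < n" for r i
    using inv_into_f_f[OF inj, of i] that by (simp add: w_def)
  have sums: "(\<Sum>v\<in>set xs. g v) = (\<Sum>i<n. g (xs ! i))" for g :: "'b \<Rightarrow> real"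
    using sum_nth_distinct[OF xs(1)] xs(2) by metis
  show thesis
  proof (rule that)
    fix r s assume rs: "r < n" "s < n"
    have "(\<Sum>v\<in>set xs. w r v * w s v) = (transpose_mat W * W) $$ (r, s)"
      using rs W(1) by (simp add: sums w scalar_prod_def lessThan_atLeast0[symmetric])
    then show "(\<Sum>v\<in>set xs. w r v * w s v) = (if r = s then 1 else 0)"
      using rs W(2) by simp
  next
    fix r v assume r: "r < n" and "v \<in> set xs"
    then obtain i where i: "i < n" "v = xs ! i" using xs(2) by (metis in_set_conv_nth)
    have "(\<Sum>t\<in>set xs. E v t * w r t) = (?A * W) $$ (i, r)"
      using r i W(1) xs(2) by (simp add: sums w scalar_prod_def lessThan_atLeast0[symmetric])
    also have "\<dots> = f r * w r v"
      unfolding AW using r i W(1) by (simp add: mat_diag_mult_right[of _ n n] w)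
    finally show "(\<Sum>t\<in>set xs. E v t * w r t) = f r * w r v" .
  qed
qed

text \<open>
  Half of the Courant--Fischer principle. The real parameter \<open>\<sigma>\<close> is meant to be \<open>1\<close> or \<open>-1\<close>, so
  that the lemma bounds the number of eigenvalues on either side of \<open>c\<close>.
\<close>

lemma eigenvalue_count_ge:
  fixes E :: "'b \<Rightarrow> 'b \<Rightarrow> real" and \<Phi> :: "'k \<Rightarrow> ('b \<Rightarrow> real) \<Rightarrow> real"
  assumes xs: "distinct xs"
    and sym: "\<And>v t. v \<in> set xs \<Longrightarrow> t \<in> set xs \<Longrightarrow> E v t = E t v"
    and K: "finite K"
    and lin: "\<And>k (R :: nat set) \<alpha> w. finite R \<Longrightarrow> k \<in> K \<Longrightarrow>
      \<Phi> k (\<lambda>v. \<Sum>r\<in>R. \<alpha> r * w r v) = (\<Sum>r\<in>R. \<alpha> r * \<Phi> k (w r))"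
    and form: "\<And>x. (\<And>k. k \<in> K \<Longrightarrow> \<Phi> k x = 0) \<Longrightarrow>
      \<sigma> * (\<Sum>v\<in>set xs. \<Sum>t\<in>set xs. E v t * x v * x t) \<le> \<sigma> * (c * (\<Sum>v\<in>set xs. (x v)\<^sup>2))"
  shows "length xs - card K
    \<le> size (filter_mset (\<lambda>\<mu>. \<sigma> * \<mu> \<le> \<sigma> * c) (proots (char_poly (indexed_mat xs E))))"
proof (rule ccontr)
  let ?n = "length xs" and ?V = "set xs"
  obtain w f where orth: "\<And>r s. r < ?n \<Longrightarrow> s < ?n \<Longrightarrow>
      (\<Sum>v\<in>?V. w r v * w s v) = (if r = s then 1 else 0 :: real)"
    and eig: "\<And>r v. r < ?n \<Longrightarrow> v \<in> ?V \<Longrightarrow> (\<Sum>t\<in>?V. E v t * w r t) = f r * w r v"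
    using orthonormal_eigenvectors_exist[of xs ?n E, OF xs refl sym] by blast
  have spec: "proots (char_poly (indexed_mat xs E)) = mset (map f [0..<?n])"
    by (rule proots_char_poly_orthonormal_eigenvectors[OF xs refl]) (fact orth eig)+
  let ?P = "\<lambda>r. \<sigma> * f r \<le> \<sigma> * c"
  define R where "R = {r \<in> {..<?n}. \<not> ?P r}"
  have R: "finite R" "\<And>r. r \<in> R \<Longrightarrow> r < ?n" "\<And>r. r \<in> R \<Longrightarrow> \<sigma> * c < \<sigma> * f r"
    by (auto simp: R_def)
  have "size (filter_mset (\<lambda>\<mu>. \<sigma> * \<mu> \<le> \<sigma> * c) (proots (char_poly (indexed_mat xs E))))
      = length (filter ?P [0..<?n])"
    by (simp only: spec mset_filter[symmetric] size_mset filter_map length_map o_def)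
  also have "\<dots> = card {r \<in> {..<?n}. ?P r}"
    by (auto simp: length_filter_conv_card intro!: arg_cong[of _ _ card])
  also have "\<dots> = ?n - card R"
  proof -
    have "{r \<in> {..<?n}. ?P r} = {..<?n} - R" by (auto simp: R_def)
    moreover have "R \<subseteq> {..<?n}" using R(2) by auto
    ultimately show ?thesis by (simp add: card_Diff_subset R(1))
  qed
  finally have size: "size (filter_mset (\<lambda>\<mu>. \<sigma> * \<mu> \<le> \<sigma> * c)
    (proots (char_poly (indexed_mat xs E)))) = ?n - card R" .
  assume "\<not> ?thesis"
  then have "card K < card R" unfolding size by linarith
  \<comment> \<open>The eigenvectors strictly beyond \<open>c\<close> outnumber the functionals, so
    a nonzero combination of them is killed by every functional. Its spectral expansion puts its
    quadratic form strictly beyond \<open>c\<close> times its squared norm, against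
    \<open>form\<close>.\<close>
  then obtain \<alpha> where \<alpha>: "\<exists>r\<in>R. \<alpha> r \<noteq> 0" "\<And>k. k \<in> K \<Longrightarrow> (\<Sum>r\<in>R. \<Phi> k (w r) * \<alpha> r) = 0"
    using homogeneous_system_nontrivial[OF K R(1), of "\<lambda>k r. \<Phi> k (w r)"] by auto
  define x where "x = (\<lambda>v. \<Sum>r\<in>R. \<alpha> r * w r v)"
  have "\<Phi> k x = 0" if "k \<in> K" for k
    using lin[OF R(1) that] \<alpha>(2)[OF that] by (simp add: x_def mult.commute)
  note le = form[OF this]
  \<comment> \<open>Orthonormal expansion with a free second coefficient family:
    \<open>g = \<alpha>\<close> gives the squared norm, \<open>g r = \<alpha> r * f r\<close> gives
    the quadratic form.\<close>
  have inner: "(\<Sum>v\<in>?V. x v * (\<Sum>s\<in>R. g s * w s v)) = (\<Sum>r\<in>R. \<alpha> r * g r)"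
    for g :: "nat \<Rightarrow> real"
  proof -
    have "(\<Sum>v\<in>?V. x v * (\<Sum>s\<in>R. g s * w s v))
        = (\<Sum>v\<in>?V. \<Sum>r\<in>R. \<Sum>s\<in>R. \<alpha> r * g s * (w r v * w s v))"
      by (simp add: x_def sum_product ac_simps)
    also have "\<dots> = (\<Sum>r\<in>R. \<Sum>v\<in>?V. \<Sum>s\<in>R. \<alpha> r * g s * (w r v * w s v))"
      by (rule sum.swap)
    also have "\<dots> = (\<Sum>r\<in>R. \<Sum>s\<in>R. \<Sum>v\<in>?V. \<alpha> r * g s * (w r v * w s v))"
      by (intro sum.cong refl sum.swap)
    also have "\<dots> = (\<Sum>r\<in>R. \<Sum>s\<in>R. if s = r then \<alpha> r * g r else 0)"
      using R(2) by (intro sum.cong refl) (auto simp: orth simp flip: sum_distrib_left)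
    also have "\<dots> = (\<Sum>r\<in>R. \<alpha> r * g r)" using R(1) by (simp add: sum.delta)
    finally show ?thesis .
  qed
  have Ex: "(\<Sum>t\<in>?V. E v t * x t) = (\<Sum>r\<in>R. (\<alpha> r * f r) * w r v)" if "v \<in> ?V" for v
  proof -
    have "(\<Sum>t\<in>?V. E v t * x t) = (\<Sum>r\<in>R. \<alpha> r * (\<Sum>t\<in>?V. E v t * w r t))"
      unfolding x_def sum_distrib_left by (subst sum.swap) (simp add: ac_simps)
    also have "\<dots> = (\<Sum>r\<in>R. (\<alpha> r * f r) * w r v)"
      using R(2) that by (intro sum.cong) (auto simp: eig)
    finally show ?thesis .
  qed
  have "(\<Sum>v\<in>?V. \<Sum>t\<in>?V. E v t * x v * x t) = (\<Sum>v\<in>?V. x v * (\<Sum>t\<in>?V. E v t * x t))"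
    by (simp add: sum_distrib_left ac_simps)
  also have "\<dots> = (\<Sum>v\<in>?V. x v * (\<Sum>r\<in>R. (\<alpha> r * f r) * w r v))"
    by (intro sum.cong refl) (simp add: Ex)
  also have "\<dots> = (\<Sum>r\<in>R. f r * (\<alpha> r)\<^sup>2)"
    unfolding inner by (simp add: power2_eq_square ac_simps)
  finally have E: "(\<Sum>v\<in>?V. \<Sum>t\<in>?V. E v t * x v * x t) = (\<Sum>r\<in>R. f r * (\<alpha> r)\<^sup>2)" .
  have N: "(\<Sum>v\<in>?V. (x v)\<^sup>2) = (\<Sum>r\<in>R. (\<alpha> r)\<^sup>2)"
    using inner[of \<alpha>] by (simp add: x_def power2_eq_square)
  have "(\<Sum>r\<in>R. \<sigma> * c * (\<alpha> r)\<^sup>2) < (\<Sum>r\<in>R. \<sigma> * f r * (\<alpha> r)\<^sup>2)"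
  proof (rule sum_strict_mono_ex1)
    show "\<forall>r\<in>R. \<sigma> * c * (\<alpha> r)\<^sup>2 \<le> \<sigma> * f r * (\<alpha> r)\<^sup>2"
      using less_imp_le[OF R(3)] by (auto intro!: mult_right_mono)
    obtain r where "r \<in> R" "\<alpha> r \<noteq> 0" using \<alpha>(1) by auto
    then show "\<exists>r\<in>R. \<sigma> * c * (\<alpha> r)\<^sup>2 < \<sigma> * f r * (\<alpha> r)\<^sup>2"
      using R(3) by (intro bexI[of _ r] mult_strict_right_mono) auto
  qed (rule R(1))
  then show False
    using le unfolding E N by (simp add: sum_distrib_left mult.assoc)
qed

text \<open>One orthonormal eigenbasis of \<open>E\<close> serves also for the square of the shifted
  matrix \<open>B\<close>, so the eigenvalues correspond with their multiplicities.\<close>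

lemma proots_char_poly_square:
  fixes E :: "'b \<Rightarrow> 'b \<Rightarrow> real"
  assumes xs: "distinct xs"
    and sym: "\<And>v t. v \<in> set xs \<Longrightarrow> t \<in> set xs \<Longrightarrow> E v t = E t v"
    and B: "\<And>v t. B v t = E v t - (if v = t then c else 0)"
  shows "proots (char_poly (indexed_mat xs (\<lambda>v t. \<Sum>s\<in>set xs. B v s * B s t)))
    = image_mset (\<lambda>\<mu>. (\<mu> - c)\<^sup>2) (proots (char_poly (indexed_mat xs E)))"
proof -
  let ?n = "length xs" and ?V = "set xs"
  obtain w f where orth: "\<And>r s. r < ?n \<Longrightarrow> s < ?n \<Longrightarrow>
      (\<Sum>v\<in>?V. w r v * w s v) = (if r = s then 1 else 0 :: real)"
    and eig: "\<And>r v. r < ?n \<Longrightarrow> v \<in> ?V \<Longrightarrow> (\<Sum>t\<in>?V. E v t * w r t) = f r * w r v"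
    using orthonormal_eigenvectors_exist[of xs ?n E, OF xs refl sym] by blast
  have Bw: "(\<Sum>t\<in>?V. B v t * w r t) = (f r - c) * w r v" if "r < ?n" "v \<in> ?V" for r v
  proof -
    have "(\<Sum>t\<in>?V. B v t * w r t) = (\<Sum>t\<in>?V. E v t * w r t - (if t = v then c * w r v else 0))"
      by (intro sum.cong) (auto simp: B algebra_simps)
    then show ?thesis using eig[OF that] that by (simp add: sum_subtractf algebra_simps)
  qed
  have sq: "(\<Sum>t\<in>?V. (\<Sum>s\<in>?V. B v s * B s t) * w r t) = (f r - c)\<^sup>2 * w r v"
    if "r < ?n" "v \<in> ?V" for r v
  proof -
    have "(\<Sum>t\<in>?V. (\<Sum>s\<in>?V. B v s * B s t) * w r t)
        = (\<Sum>s\<in>?V. B v s * (\<Sum>t\<in>?V. B s t * w r t))"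
      unfolding sum_distrib_left sum_distrib_right by (subst sum.swap) (simp add: mult.assoc)
    also have "\<dots> = (\<Sum>s\<in>?V. (f r - c) * (B v s * w r s))"
      using that by (intro sum.cong refl) (simp add: Bw)
    also have "\<dots> = (f r - c)\<^sup>2 * w r v"
      using that by (simp add: Bw power2_eq_square flip: sum_distrib_left)
    finally show ?thesis .
  qed
  have "proots (char_poly (indexed_mat xs (\<lambda>v t. \<Sum>s\<in>?V. B v s * B s t)))
    = mset (map (\<lambda>r. (f r - c)\<^sup>2) [0..<?n])"
    by (rule proots_char_poly_orthonormal_eigenvectors[OF xs refl]) (fact orth sq)+
  moreover have "proots (char_poly (indexed_mat xs E)) = mset (map f [0..<?n])"
    by (rule proots_char_poly_orthonormal_eigenvectors[OF xs refl]) (fact orth eig)+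
  ultimately show ?thesis by (simp add: image_mset.compositionality o_def)
qed
section \<open>The quadratic form of a path\<close>

text \<open>Each step changes sign and adds a perturbation, so \<bar>y m\<bar> exceeds \<bar>y
  0\<bar> by at most the accumulated perturbations, which Cauchy-Schwarz bounds. Summing over m
  produces 2 (0 + ... + l) = l (l + 1) \<le> (l + 1)^2.\<close>

lemma alternating_recurrence_sum_squares:
  fixes y z :: "nat \<Rightarrow> real"
  assumes rec: "\<And>m. m < l \<Longrightarrow> y (Suc m) = \<epsilon> * z m - y m"
  shows "(\<Sum>m\<le>l. (y m)\<^sup>2)
    \<le> 2 * real (Suc l) * (y 0)\<^sup>2 + (\<epsilon> * real (Suc l))\<^sup>2 * (\<Sum>m<l. (z m)\<^sup>2)"
proof -
  define S where "S = (\<Sum>m<l. (z m)\<^sup>2)"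
  have S: "0 \<le> S" unfolding S_def by (intro sum_nonneg) auto
  have abs: "\<bar>y m\<bar> \<le> \<bar>y 0\<bar> + \<bar>\<epsilon>\<bar> * (\<Sum>k<m. \<bar>z k\<bar>)" if "m \<le> l" for m
    using that
  proof (induction m)
    case (Suc m)
    have "\<bar>y (Suc m)\<bar> \<le> \<bar>\<epsilon>\<bar> * \<bar>z m\<bar> + \<bar>y m\<bar>"
      using rec[of m] Suc.prems abs_triangle_ineq4[of "\<epsilon> * z m" "y m"] by (simp add: abs_mult)
    then show ?case using Suc by (simp add: algebra_simps)
  qed simp
  have sq: "(y m)\<^sup>2 \<le> 2 * (y 0)\<^sup>2 + 2 * \<epsilon>\<^sup>2 * S * real m" if m: "m \<le> l" for m
  proof -
    have "(y m)\<^sup>2 \<le> (\<bar>y 0\<bar> + \<bar>\<epsilon>\<bar> * (\<Sum>k<m. \<bar>z k\<bar>))\<^sup>2"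
      using abs[OF m] by (metis abs_ge_zero power2_abs power_mono)
    also have "\<dots> \<le> 2 * (y 0)\<^sup>2 + 2 * \<epsilon>\<^sup>2 * (\<Sum>k<m. \<bar>z k\<bar>)\<^sup>2"
      using sum_squares_bound[of "\<bar>y 0\<bar>" "\<bar>\<epsilon>\<bar> * (\<Sum>k<m. \<bar>z k\<bar>)"]
      by (simp add: power2_sum power_mult_distrib)
    also have "\<dots> \<le> 2 * (y 0)\<^sup>2 + 2 * \<epsilon>\<^sup>2 * (real m * S)"
    proof (intro add_left_mono mult_left_mono)
      have "(\<Sum>k<m. \<bar>z k\<bar>)\<^sup>2 \<le> real m * (\<Sum>k<m. (z k)\<^sup>2)"
        using sum_squared_le_sum_of_squares[of "\<lambda>k. \<bar>z k\<bar>" "{..<m}"] by (simp add: mult.commute)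
      also have "\<dots> \<le> real m * S"
        using m by (auto simp: S_def intro!: mult_left_mono sum_mono2)
      finally show "(\<Sum>k<m. \<bar>z k\<bar>)\<^sup>2 \<le> real m * S" .
    qed simp
    finally show ?thesis by (simp add: ac_simps)
  qed
  have "(\<Sum>m\<le>l. (y m)\<^sup>2) \<le> (\<Sum>m\<le>l. 2 * (y 0)\<^sup>2 + 2 * \<epsilon>\<^sup>2 * S * real m)"
    by (intro sum_mono sq) simp
  also have "\<dots> = 2 * real (Suc l) * (y 0)\<^sup>2 + \<epsilon>\<^sup>2 * S * (2 * (\<Sum>m\<le>l. real m))"
    by (simp add: sum.distrib sum_distrib_left ac_simps)
  also have "2 * (\<Sum>m\<le>l. real m) = real l * real (Suc l)"
    by (induction l) (auto simp: algebra_simps)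
  also have "\<epsilon>\<^sup>2 * S * (real l * real (Suc l)) \<le> (\<epsilon> * real (Suc l))\<^sup>2 * S"
    using mult_left_mono[of "real l * real (Suc l)" "(real (Suc l))\<^sup>2" "\<epsilon>\<^sup>2 * S"] S
    by (simp add: power_mult_distrib power2_eq_square ac_simps)
  finally show ?thesis by (simp add: S_def)
qed

lemma paired_path_form_ge:
  fixes f :: "nat \<Rightarrow> real"
  assumes "\<And>m. m < l \<Longrightarrow> f (2 * m) + f (Suc (2 * m)) = 0"
  shows "2 * (\<Sum>j<2 * l. (f j)\<^sup>2) \<le> (\<Sum>j<2 * l. (f j - f (Suc j))\<^sup>2)"
  using assms
proof (induction l)
  case (Suc l)
  have "f (Suc (2 * l)) = - f (2 * l)" using Suc.prems[of l] by simp
  then have "2 * (f (2 * l))\<^sup>2 + 2 * (f (Suc (2 * l)))\<^sup>2 = (f (2 * l) - f (Suc (2 * l)))\<^sup>2"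
    by (simp add: power2_eq_square)
  moreover have "0 \<le> (f (Suc (2 * l)) - f (Suc (Suc (2 * l))))\<^sup>2" by simp
  moreover have "2 * (\<Sum>j<2 * l. (f j)\<^sup>2) \<le> (\<Sum>j<2 * l. (f j - f (Suc j))\<^sup>2)"
    using Suc by simp
  moreover have split: "(\<Sum>j<2 * Suc l. g j) = (\<Sum>j<2 * l. g j) + g (2 * l) + g (Suc (2 * l))"
    for g :: "nat \<Rightarrow> real" by simp
  ultimately show ?case unfolding split by argo
qed simp

text \<open>Index 0 stands for the leaf and \<open>b\<close> for the centre. For odd
  \<open>b\<close> the last pair contains the centre; for even \<open>b\<close> the centre stays
  unmatched in this branch.\<close>

lemma path_form_ge:
  fixes f :: "nat \<Rightarrow> real"
  assumes pair: "\<And>m. m < Suc b div 2 \<Longrightarrow> f (2 * m) + f (Suc (2 * m)) = 0"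
  shows "2 * (\<Sum>j<2 * (Suc b div 2). (f j)\<^sup>2) \<le> (\<Sum>j<b. (f j - f (Suc j))\<^sup>2)"
proof (cases "even b")
  case True
  then show ?thesis using paired_path_form_ge[of "Suc b div 2" f] pair by simp
next
  case False
  then obtain l where b: "b = Suc (2 * l)" by (metis oddE Suc_eq_plus1)
  \<comment> \<open>The last pair is treated separately, because the bound for \<open>l + 1\<close>
    pairs would include an edge beyond index \<open>b\<close>.\<close>
  have "2 * (\<Sum>j<2 * l. (f j)\<^sup>2) \<le> (\<Sum>j<2 * l. (f j - f (Suc j))\<^sup>2)"
    using paired_path_form_ge[of l f] pair b by simp
  moreover have "f (Suc (2 * l)) = - f (2 * l)" using pair[of l] b by simp
  then have "2 * (f (2 * l))\<^sup>2 + 2 * (f (Suc (2 * l)))\<^sup>2 = (f (2 * l) - f (Suc (2 * l)))\<^sup>2"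
    by (simp add: power2_eq_square)
  ultimately show ?thesis by (simp add: b algebra_simps)
qed

lemma sum_even_odd_split:
  fixes g :: "nat \<Rightarrow> real"
  shows "(\<Sum>j<2 * l. g j) = (\<Sum>m<l. g (2 * m)) + (\<Sum>m<l. g (Suc (2 * m)))"
  by (induction l) auto

text \<open>Every edge has one end of odd index, so the recurrence, with \<open>f b = 0\<close> for
  a last edge at odd \<open>b\<close>, turns the sum of cross terms into \<epsilon> S, where S is
  the square sum over odd indices. With Y the square sum over even indices, the claim becomes
  \<epsilon> Y \<le> (f 0)^2 + \<epsilon> S; the term (f 0)^2 is gained because the leaf has degree
  1.\<close>

lemma path_form_le:
  fixes f :: "nat \<Rightarrow> real"
  assumes zero: "f b = 0" and \<epsilon>: "0 \<le> \<epsilon>"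
    and rec: "\<And>m. m < b div 2 \<Longrightarrow> f (2 * m) + f (Suc (Suc (2 * m))) = \<epsilon> * f (Suc (2 * m))"
    and small: "even b \<Longrightarrow> \<epsilon> * (real b + 2) \<le> 2" "odd b \<Longrightarrow> \<epsilon> * (real b + 1) \<le> 1"
    and b: "0 < b"
  shows "(\<Sum>j<b. (f j - f (Suc j))\<^sup>2) \<le> (2 - \<epsilon>) * (\<Sum>j<b. (f j)\<^sup>2)"
proof -
  define l where "l = b div 2"
  define z where "z m = f (Suc (2 * m))" for m
  define S where "S = (\<Sum>m<l. (z m)\<^sup>2)"
  define Y where "Y = (\<Sum>m\<le>l. (f (2 * m))\<^sup>2)"
  have S: "0 \<le> S" unfolding S_def by (intro sum_nonneg) auto
  have "(\<Sum>j<b. (f j - f (Suc j))\<^sup>2)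
      = (\<Sum>j<b. (f j)\<^sup>2) + (\<Sum>j<b. (f (Suc j))\<^sup>2) - 2 * (\<Sum>j<b. f j * f (Suc j))"
    by (simp add: power2_diff sum.distrib sum_subtractf sum_distrib_left mult.assoc)
  also have "(\<Sum>j<b. (f (Suc j))\<^sup>2) = (\<Sum>j<b. (f j)\<^sup>2) - (f 0)\<^sup>2"
    using sum.lessThan_Suc_shift[of "\<lambda>j. (f j)\<^sup>2" b] zero by simp
  also have "(\<Sum>j<b. f j * f (Suc j)) = (\<Sum>j<2 * l. f j * f (Suc j))"
  proof (cases "even b")
    case False
    then have "b = Suc (2 * l)" unfolding l_def by presburger
    then show ?thesis using zero by simp
  qed (simp add: l_def)
  also have "\<dots> = (\<Sum>m<l. z m * (f (2 * m) + f (Suc (Suc (2 * m)))))"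
    unfolding sum_even_odd_split sum.distrib[symmetric] z_def
    by (intro sum.cong refl) (simp add: distrib_left mult.commute)
  also have "\<dots> = \<epsilon> * S"
    unfolding S_def sum_distrib_left
    by (intro sum.cong refl) (simp add: rec l_def z_def power2_eq_square)
  finally have form: "(\<Sum>j<b. (f j - f (Suc j))\<^sup>2)
    = 2 * (\<Sum>j<b. (f j)\<^sup>2) - (f 0)\<^sup>2 - 2 * (\<epsilon> * S)" by simp
  have norm: "(\<Sum>j<b. (f j)\<^sup>2) = S + Y"
  proof (cases "even b")
    case True
    then have "b = 2 * l" by (simp add: l_def)
    then show ?thesis using zero
      by (simp add: sum_even_odd_split S_def Y_def z_def lessThan_Suc_atMost[symmetric])
  next
    case False
    then have "b = Suc (2 * l)" unfolding l_def by presburger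
    then show ?thesis
      by (simp add: sum_even_odd_split S_def Y_def z_def lessThan_Suc_atMost[symmetric])
  qed
  have "\<epsilon> * Y \<le> (f 0)\<^sup>2 + \<epsilon> * S"
  proof (cases "even b")
    case True
    then have bl: "b = 2 * l" by (simp add: l_def)
    have "l \<noteq> 0" using bl b by simp
    \<comment> \<open>For even \<open>b\<close> the recurrence is run from the centre towards the
      leaf, so its initial value is 0.\<close>
    have "(\<Sum>m\<le>l. (f (2 * (l - m)))\<^sup>2)
        \<le> 2 * real (Suc l) * (f (2 * (l - 0)))\<^sup>2
          + (\<epsilon> * real (Suc l))\<^sup>2 * (\<Sum>m<l. (z (l - Suc m))\<^sup>2)"
    proof (rule alternating_recurrence_sum_squares)
      fix m assume "m < l"
      then obtain q where q: "l = Suc (m + q)" using less_imp_Suc_add by blast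
      show "f (2 * (l - Suc m)) = \<epsilon> * z (l - Suc m) - f (2 * (l - m))"
        using rec[of q] bl q by (simp add: z_def)
    qed
    also have "(\<Sum>m\<le>l. (f (2 * (l - m)))\<^sup>2) = Y"
      unfolding Y_def atMost_atLeast0 by (rule sum.atLeastAtMost_rev[of _ 0 l, simplified, symmetric])
    also have "(\<Sum>m<l. (z (l - Suc m))\<^sup>2) = S"
      unfolding S_def by (rule sum.nat_diff_reindex)
    finally have "Y \<le> (\<epsilon> * real (Suc l))\<^sup>2 * S" using zero bl by simp
    also have "\<dots> \<le> 1 * S"
    proof (rule mult_right_mono[OF _ S])
      have "\<epsilon> * real (Suc l) \<le> 1" using small(1)[OF True] bl by (simp add: algebra_simps)
      then show "(\<epsilon> * real (Suc l))\<^sup>2 \<le> 1" using \<epsilon> by (simp add: power_le_one)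
    qed
    finally have "\<epsilon> * Y \<le> \<epsilon> * S" using \<epsilon> by (simp add: mult_left_mono)
    then show ?thesis by (simp add: add_increasing)
  next
    case False
    then have bl: "b = Suc (2 * l)" unfolding l_def by presburger
    \<comment> \<open>For odd \<open>b\<close> the centre has odd index and the recurrence starts at
      the leaf. After multiplication by \<epsilon>, the coefficient of (f 0)^2 is \<epsilon> (b +
      1), which must not exceed the available 1; hence the stricter bound for odd
      \<open>b\<close>.\<close>
    have "Y \<le> 2 * real (Suc l) * (f (2 * 0))\<^sup>2 + (\<epsilon> * real (Suc l))\<^sup>2 * S"
      unfolding Y_def S_def
    proof (rule alternating_recurrence_sum_squares)
      fix m assume "m < l"
      then show "f (2 * Suc m) = \<epsilon> * z m - f (2 * m)" using rec[of m] by (simp add: l_def z_def)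
    qed
    then have "\<epsilon> * Y \<le> (2 * (\<epsilon> * real (Suc l))) * (f 0)\<^sup>2 + \<epsilon> * ((\<epsilon> * real (Suc l))\<^sup>2 * S)"
      using mult_left_mono[OF _ \<epsilon>] by (fastforce simp: algebra_simps)
    also have "\<dots> \<le> 1 * (f 0)\<^sup>2 + \<epsilon> * (1 * S)"
    proof (intro add_mono mult_right_mono mult_left_mono \<epsilon> S)
      have le: "2 * (\<epsilon> * real (Suc l)) \<le> 1" using small(2)[OF False] bl by (simp add: algebra_simps)
      then show "2 * (\<epsilon> * real (Suc l)) \<le> 1" .
      have "\<epsilon> * real (Suc l) \<le> 1" using le \<epsilon> by linarith
      then show "(\<epsilon> * real (Suc l))\<^sup>2 \<le> 1" using \<epsilon> by (simp add: power_le_one)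
    qed simp
    finally show ?thesis by simp
  qed
  then show ?thesis unfolding form norm by (simp add: algebra_simps)
qed
section \<open>Laplacians of starlike trees\<close>

definition laplacian_entry :: "'a pair_pre_digraph \<Rightarrow> 'a \<Rightarrow> 'a \<Rightarrow> real" where
  "laplacian_entry G v w
    = (if v = w then real (vertex_degree G v) else 0) - (if (v, w) \<in> parcs G then 1 else 0)"

lemma laplacian_mat_eq_indexed_mat:
  "distinct vs \<Longrightarrow> laplacian_mat vs G = indexed_mat vs (laplacian_entry G)"
  by (intro eq_matI) (auto simp: laplacian_mat_def degree_mat_def adjacency_mat_def
      laplacian_entry_def nth_eq_iff_index_eq)

lemma laplacian_entry_commute:
  assumes "sym (parcs G)"
  shows "laplacian_entry G v w = laplacian_entry G w v"
  using assms by (auto simp: laplacian_entry_def sym_def)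

lemma vertex_degree_eq_card: "vertex_degree G v = card {e \<in> parcs G. fst e = v}"
  by (simp add: out_degree_def out_arcs_def)

lemma sum_arcs_tail:
  fixes g :: "'a \<Rightarrow> real"
  assumes "finite (pverts G)" "parcs G \<subseteq> pverts G \<times> pverts G"
  shows "(\<Sum>e\<in>parcs G. g (fst e)) = (\<Sum>v\<in>pverts G. real (vertex_degree G v) * g v)"
proof -
  have "finite (parcs G)" using assms finite_subset by blast
  then have "(\<Sum>e\<in>parcs G. g (fst e))
      = (\<Sum>v\<in>pverts G. \<Sum>e\<in>{e \<in> parcs G. fst e = v}. g (fst e))"
    using assms by (intro sum.group[symmetric]) auto
  also have "\<dots> = (\<Sum>v\<in>pverts G. \<Sum>e\<in>{e \<in> parcs G. fst e = v}. g v)"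
    by (intro sum.cong) auto
  finally show ?thesis by (simp add: vertex_degree_eq_card)
qed

lemma average_degree_eq_card_arcs:
  assumes "finite (pverts G)" "parcs G \<subseteq> pverts G \<times> pverts G"
  shows "average_degree G = real (card (parcs G)) / real (card (pverts G))"
  using sum_arcs_tail[OF assms, of "\<lambda>_. 1"] by (simp add: average_degree_def)

text \<open>Each arc carries half an edge: the terms of two opposite arcs add up to the square of a
  difference, see \<open>quadratic_form\<close>.\<close>

lemma laplacian_quadratic_form:
  fixes x :: "'a \<Rightarrow> real"
  assumes "finite (pverts G)" "parcs G \<subseteq> pverts G \<times> pverts G"
  shows "(\<Sum>v\<in>pverts G. \<Sum>w\<in>pverts G. laplacian_entry G v w * x v * x w)
    = (\<Sum>e\<in>parcs G. (x (fst e))\<^sup>2 - x (fst e) * x (snd e))"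
proof -
  let ?V = "pverts G"
  have "(\<Sum>e\<in>parcs G. x (fst e) * x (snd e))
      = (\<Sum>e\<in>?V \<times> ?V. if e \<in> parcs G then x (fst e) * x (snd e) else 0)"
    using assms by (simp add: sum.If_cases Int_absorb1)
  also have "\<dots> = (\<Sum>v\<in>?V. \<Sum>w\<in>?V. if (v, w) \<in> parcs G then x v * x w else 0)"
    unfolding sum.cartesian_product by (intro sum.cong) auto
  finally have adj: "(\<Sum>e\<in>parcs G. x (fst e) * x (snd e)) = \<dots>" .
  have "(\<Sum>w\<in>?V. laplacian_entry G v w * x v * x w)
      = real (vertex_degree G v) * (x v)\<^sup>2
        - (\<Sum>w\<in>?V. if (v, w) \<in> parcs G then x v * x w else 0)" if "v \<in> ?V" for v
  proof -
    have "(\<Sum>w\<in>?V. laplacian_entry G v w * x v * x w)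
      = (\<Sum>w\<in>?V. (if v = w then real (vertex_degree G v) * (x v)\<^sup>2 else 0)
          - (if (v, w) \<in> parcs G then x v * x w else 0))"
      by (intro sum.cong) (auto simp: laplacian_entry_def power2_eq_square algebra_simps)
    then show ?thesis using that assms(1) by (simp add: sum_subtractf sum.delta)
  qed
  then show ?thesis
    by (simp add: sum_subtractf adj sum_arcs_tail[OF assms, of "\<lambda>v. (x v)\<^sup>2"])
qed

lemma sum_abs_diff_eq:
  fixes M :: "real multiset"
  assumes "size M = 2 * q" "c < d"
    and L: "q \<le> size (filter_mset (\<lambda>\<mu>. \<mu> \<le> c) M)" and U: "q \<le> size (filter_mset (\<lambda>\<mu>. d \<le> \<mu>) M)"
  shows "(\<Sum>\<mu>\<in>#M. \<bar>\<mu> - c\<bar>) = (\<Sum>\<mu>\<in>#M. \<bar>\<mu> - d\<bar>)"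
proof -
  define X where "X = filter_mset (\<lambda>\<mu>. \<mu> \<le> c) M"
  define Y where "Y = filter_mset (\<lambda>\<mu>. \<not> \<mu> \<le> c) M"
  have M: "M = X + Y" unfolding X_def Y_def by (rule multiset_partition)
  have sub: "filter_mset (\<lambda>\<mu>. d \<le> \<mu>) M \<subseteq># Y"
    unfolding Y_def using assms(2) by (metis (mono_tags, lifting) filter_mset_mono_strong linorder_not_le order_less_le_trans subset_mset.order_refl)
  \<comment> \<open>The two counts exhaust \<open>M\<close>, so nothing lies strictly between
    \<open>c\<close> and \<open>d\<close>. Moving the reference point then gains d - c on one half
    and loses it on the other.\<close>
  have size: "size X = q" "size Y = q"
    using size_mset_mono[OF sub] L U assms(1) arg_cong[OF M, of size] by (auto simp: X_def)
  have "filter_mset (\<lambda>\<mu>. d \<le> \<mu>) M = Y"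
    using sub size(2) U mset_subset_size[of _ Y] by (metis leD subset_mset.le_imp_less_or_eq)
  then have Y: "\<And>\<mu>. \<mu> \<in># Y \<Longrightarrow> d \<le> \<mu>" by (metis filter_mset_eq_conv)
  have "(\<Sum>\<mu>\<in>#X. \<bar>\<mu> - d\<bar>) = (\<Sum>\<mu>\<in>#X. \<bar>\<mu> - c\<bar> + (d - c))"
    using assms(2) by (intro arg_cong[of _ _ sum_mset] image_mset_cong) (auto simp: X_def)
  moreover have "(\<Sum>\<mu>\<in>#Y. \<bar>\<mu> - c\<bar>) = (\<Sum>\<mu>\<in>#Y. \<bar>\<mu> - d\<bar> + (d - c))"
    using assms(2) Y by (intro arg_cong[of _ _ sum_mset] image_mset_cong) fastforce
  ultimately show ?thesis by (simp add: M sum_mset.distrib size)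
qed

lemma sum_lessThan_rev:
  fixes g :: "nat \<Rightarrow> real"
  shows "(\<Sum>j<b. g (b - j)) = (\<Sum>j=1..b. g j)"
  by (rule sum.reindex_bij_witness[of _ "\<lambda>j. b - j" "\<lambda>j. b - j"]) auto

lemma Collect_eq_image_Sigma:
  "{g i j |i j. i \<in> I \<and> j < b i} = (\<lambda>(i, j). g i j) ` (SIGMA i:I. {..<b i})"
  by force

section \<open>Coordinates, arcs and quadratic form of a starlike tree\<close>

locale starlike =
  fixes G :: "'a pair_pre_digraph" and u :: 'a and h :: nat
    and a :: "nat \<Rightarrow> nat" and p :: "nat \<Rightarrow> nat \<Rightarrow> 'a"
  assumes starlike: "starlike_tree G u h a p" and h: "1 \<le> h"
begin

lemma branch_zero: "i \<in> {1..h} \<Longrightarrow> p i 0 = u" and branch_pos: "i \<in> {1..h} \<Longrightarrow> 1 \<le> a i"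
  using starlike unfolding starlike_tree_def by auto

text \<open>With j = 0 allowed, the centre is the start of every branch, and it is the only vertex
  whose coordinates are ambiguous.\<close>

lemma p_eq_iff:
  assumes "i \<in> {1..h}" "i' \<in> {1..h}" "j \<le> a i" "j' \<le> a i'"
  shows "p i j = p i' j' \<longleftrightarrow> j = 0 \<and> j' = 0 \<or> i = i' \<and> j = j'"
proof (cases "j = 0 \<or> j' = 0")
  case True
  have "p r s \<noteq> u" if "r \<in> {1..h}" "s \<le> a r" "s \<noteq> 0" for r s
    using starlike that unfolding starlike_tree_def by auto
  then show ?thesis using True assms branch_zero by metis
next
  case False
  then have mem: "(i, j) \<in> (SIGMA i:{1..h}. {1..a i})" "(i', j') \<in> (SIGMA i:{1..h}. {1..a i})"
    using assms by auto
  have "inj_on (\<lambda>(i, j). p i j) (SIGMA i:{1..h}. {1..a i})"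
    using starlike unfolding starlike_tree_def by auto
  from inj_onD[OF this _ mem] False show ?thesis by auto
qed

lemma arcs:
  "parcs G = (\<lambda>(i, j). (p i j, p i (Suc j))) ` (SIGMA i:{1..h}. {..<a i})
    \<union> (\<lambda>(i, j). (p i (Suc j), p i j)) ` (SIGMA i:{1..h}. {..<a i})"
proof -
  have "parcs G = {(p i j, p i (Suc j)) |i j. i \<in> {1..h} \<and> j < a i}
      \<union> {(p i (Suc j), p i j) |i j. i \<in> {1..h} \<and> j < a i}"
    using starlike unfolding starlike_tree_def by blast
  then show ?thesis by (simp only: Collect_eq_image_Sigma)
qed

lemma arc_iff_ex:
  "(v, w) \<in> parcs G \<longleftrightarrow> (\<exists>i\<in>{1..h}. \<exists>j<a i.
    v = p i j \<and> w = p i (Suc j) \<or> v = p i (Suc j) \<and> w = p i j)"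
proof -
  have "parcs G = {(p i j, p i (Suc j)) |i j. i \<in> {1..h} \<and> j < a i}
      \<union> {(p i (Suc j), p i j) |i j. i \<in> {1..h} \<and> j < a i}"
    using starlike unfolding starlike_tree_def by blast
  then show ?thesis by blast
qed

lemma vert_iff: "v \<in> pverts G \<longleftrightarrow> (\<exists>i\<in>{1..h}. \<exists>j\<le>a i. v = p i j)"
proof
  assume "v \<in> pverts G"
  then consider "v = u" | i j where "i \<in> {1..h}" "j \<in> {1..a i}" "v = p i j"
    using starlike_tree_verts[OF starlike] by auto
  then show "\<exists>i\<in>{1..h}. \<exists>j\<le>a i. v = p i j"
  proof cases
    case 1
    then show ?thesis using branch_zero[of 1] h by force
  next
    case 2
    then show ?thesis by auto
  qed
next
  assume "\<exists>i\<in>{1..h}. \<exists>j\<le>a i. v = p i j"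
  then obtain i j where ij: "i \<in> {1..h}" "j \<le> a i" "v = p i j" by blast
  show "v \<in> pverts G"
  proof (cases "j = 0")
    case True
    then show ?thesis using ij branch_zero starlike_tree_verts[OF starlike] by auto
  next
    case False
    then have "(i, j) \<in> (SIGMA i:{1..h}. {1..a i})" using ij by auto
    then show ?thesis using ij(3) starlike_tree_verts[OF starlike] by force
  qed
qed

lemma pair_graph: "pair_graph G"
  using starlike_tree_pair_graph[OF starlike h] .

lemma finite_verts: "finite (pverts G)"
  and arcs_subset: "parcs G \<subseteq> pverts G \<times> pverts G"
  and sym_arcs: "sym (parcs G)"
proof -
  show "finite (pverts G)" using starlike_tree_verts[OF starlike] by simp
  have "p i j \<in> pverts G" if "i \<in> {1..h}" "j \<le> a i" for i j
    using that vert_iff by blast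
  then show "parcs G \<subseteq> pverts G \<times> pverts G"
    by (auto simp only: arc_iff_ex mem_Sigma_iff less_imp_le Suc_le_eq)
  show "sym (parcs G)" unfolding sym_def arc_iff_ex by blast
qed

lemma arc_iff:
  assumes "i \<in> {1..h}" "i' \<in> {1..h}" "j \<le> a i" "j' \<le> a i'"
  shows "(p i j, p i' j') \<in> parcs G
    \<longleftrightarrow> j' = Suc j \<and> (i = i' \<or> j = 0) \<or> j = Suc j' \<and> (i = i' \<or> j' = 0)"
proof -
  have "(p i j, p i' j') \<in> parcs G \<longleftrightarrow> (\<exists>r\<in>{1..h}. \<exists>s<a r.
      p i j = p r s \<and> p i' j' = p r (Suc s) \<or> p i j = p r (Suc s) \<and> p i' j' = p r s)"
    by (rule arc_iff_ex)
  also have "\<dots> \<longleftrightarrow> (\<exists>r\<in>{1..h}. \<exists>s<a r.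
      (j = 0 \<and> s = 0 \<or> i = r \<and> j = s) \<and> i' = r \<and> j' = Suc s
      \<or> i = r \<and> j = Suc s \<and> (j' = 0 \<and> s = 0 \<or> i' = r \<and> j' = s))"
    using assms by (intro bex_cong ex_cong refl) (auto simp: p_eq_iff)
  also have "\<dots> \<longleftrightarrow> j' = Suc j \<and> (i = i' \<or> j = 0) \<or> j = Suc j' \<and> (i = i' \<or> j' = 0)"
  proof
    assume "j' = Suc j \<and> (i = i' \<or> j = 0) \<or> j = Suc j' \<and> (i = i' \<or> j' = 0)"
    then show "\<exists>r\<in>{1..h}. \<exists>s<a r.
        (j = 0 \<and> s = 0 \<or> i = r \<and> j = s) \<and> i' = r \<and> j' = Suc s
        \<or> i = r \<and> j = Suc s \<and> (j' = 0 \<and> s = 0 \<or> i' = r \<and> j' = s)"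
    proof
      assume "j' = Suc j \<and> (i = i' \<or> j = 0)"
      then show ?thesis using assms by (intro bexI[of _ i'] exI[of _ j]) auto
    next
      assume "j = Suc j' \<and> (i = i' \<or> j' = 0)"
      then show ?thesis using assms by (intro bexI[of _ i] exI[of _ j']) auto
    qed
  qed auto
  finally show ?thesis .
qed

lemma sum_verts:
  fixes g :: "'a \<Rightarrow> real"
  shows "(\<Sum>v\<in>pverts G. g v) = g u + (\<Sum>i=1..h. \<Sum>j=1..a i. g (p i j))"
proof -
  let ?I = "SIGMA i:{1..h}. {1..a i}" and ?f = "\<lambda>(i, j). p i j"
  have "u \<notin> ?f ` ?I" "inj_on ?f ?I"
    using starlike unfolding starlike_tree_def by auto
  then show ?thesis
    unfolding starlike_tree_verts[OF starlike]
    by (simp add: sum.reindex sum.Sigma split_def)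
qed

lemma sum_arcs:
  fixes g :: "'a \<times> 'a \<Rightarrow> real"
  shows "(\<Sum>e\<in>parcs G. g e)
    = (\<Sum>i=1..h. \<Sum>j<a i. g (p i j, p i (Suc j)) + g (p i (Suc j), p i j))"
proof -
  let ?I = "SIGMA i:{1..h}. {..<a i}"
  let ?f = "\<lambda>(i, j). (p i j, p i (Suc j))" and ?b = "\<lambda>(i, j). (p i (Suc j), p i j)"
  have "?f ` ?I \<inter> ?b ` ?I = {}" by (auto simp: p_eq_iff)
  moreover have "inj_on ?f ?I" "inj_on ?b ?I" by (auto simp: inj_on_def p_eq_iff)
  ultimately have "(\<Sum>e\<in>parcs G. g e) = (\<Sum>e\<in>?I. g (?f e)) + (\<Sum>e\<in>?I. g (?b e))"
    unfolding arcs by (subst sum.union_disjoint) (auto simp: sum.reindex)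
  then show ?thesis by (simp add: sum.distrib[symmetric] sum.Sigma split_def)
qed

lemma card_arcs: "real (card (parcs G)) = 2 * (real (card (pverts G)) - 1)"
  using sum_arcs[of "\<lambda>_. 1"] starlike_tree_card[OF starlike]
  by (simp add: sum_distrib_left mult.commute)

lemma degree:
  assumes "i \<in> {1..h}" "1 \<le> j" "j \<le> a i"
  shows "vertex_degree G (p i j) = (if j = a i then 1 else 2)"
proof -
  obtain s where j: "j = Suc s" using assms(2) by (cases j) auto
  have "{e \<in> parcs G. fst e = p i j}
      = (\<lambda>w. (p i j, w)) ` ({p i s} \<union> (if j = a i then {} else {p i (Suc j)}))" (is "?L = ?R")
  proof
    show "?R \<subseteq> ?L" using assms j by (auto simp: arc_iff)
    show "?L \<subseteq> ?R"
    proof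
      fix e assume e: "e \<in> ?L"
      then obtain w where w: "e = (p i j, w)" "(p i j, w) \<in> parcs G" by (cases e) auto
      then obtain i' j' where ij: "i' \<in> {1..h}" "j' \<le> a i'" "w = p i' j'"
        using arcs_subset vert_iff by blast
      then have "i = i' \<and> j' = Suc j \<or> j' = s \<and> (i = i' \<or> j' = 0)"
        using w(2) assms j by (auto simp: arc_iff)
      then show "e \<in> ?R"
      proof
        assume *: "i = i' \<and> j' = Suc j"
        then show ?thesis using w(1) ij by auto
      next
        assume *: "j' = s \<and> (i = i' \<or> j' = 0)"
        then have "w = p i s" using ij branch_zero assms(1) by metis
        then show ?thesis using w(1) by auto
      qed
    qed
  qed
  moreover have "p i s \<noteq> p i (Suc j)" if "j \<noteq> a i" using assms that j by (simp add: p_eq_iff)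
  ultimately show ?thesis
    unfolding vertex_degree_eq_card by (simp add: card_image inj_on_def)
qed

lemma quadratic_form:
  fixes x :: "'a \<Rightarrow> real"
  shows "(\<Sum>v\<in>pverts G. \<Sum>w\<in>pverts G. laplacian_entry G v w * x v * x w)
    = (\<Sum>i=1..h. \<Sum>j<a i. (x (p i j) - x (p i (Suc j)))\<^sup>2)"
  unfolding laplacian_quadratic_form[OF finite_verts arcs_subset] sum_arcs
  by (intro sum.cong refl) (simp add: power2_eq_square algebra_simps)

section \<open>Eigenvalue counts for the tree\<close>

abbreviation spectrum_mset :: "real multiset" where
  "spectrum_mset \<equiv> proots (char_poly (indexed_mat (vertex_enum G) (laplacian_entry G)))"

text \<open>The path estimates count from the leaf, where the matching begins, whereas
  \<open>p\<close> counts from the centre.\<close>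

lemma branch_form_rev:
  fixes x :: "'a \<Rightarrow> real"
  shows "(\<Sum>j<a i. (x (p i (a i - j)) - x (p i (a i - Suc j)))\<^sup>2)
    = (\<Sum>j<a i. (x (p i j) - x (p i (Suc j)))\<^sup>2)"
proof -
  have "(\<Sum>j<a i. (x (p i j) - x (p i (Suc j)))\<^sup>2)
      = (\<Sum>j<a i. (x (p i (a i - Suc j)) - x (p i (Suc (a i - Suc j))))\<^sup>2)"
    by (rule sum.nat_diff_reindex[symmetric])
  also have "\<dots> = (\<Sum>j<a i. (x (p i (a i - j)) - x (p i (a i - Suc j)))\<^sup>2)"
    by (intro sum.cong refl) (simp add: Suc_diff_Suc power2_commute)
  finally show ?thesis by simp
qed

text \<open>
  The constraints make \<open>x\<close> antisymmetric along the perfect matching of the tree, so the matching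
  edges alone already contribute \<open>2 * \<parallel>x\<parallel>\<^sup>2\<close> to the quadratic form.
\<close>

lemma eigenvalues_ge_2:
  assumes even: "\<And>i. i \<in> {1..<h} \<Longrightarrow> even (a i)" and odd: "odd (a h)"
  shows "card (pverts G) div 2 \<le> size (filter_mset (\<lambda>\<mu>. 2 \<le> \<mu>) spectrum_mset)"
proof -
  let ?n = "card (pverts G)" and ?vs = "vertex_enum G"
  note vs = vertex_enum[OF finite_verts]
  have split_h: "{1..h} = insert h {1..<h}" using h by auto
  let ?K = "SIGMA i:{1..h}. {..<Suc (a i) div 2}"
  have "2 * card ?K = (\<Sum>i=1..h. 2 * (Suc (a i) div 2))" by (simp add: sum_distrib_left)
  also have "\<dots> = Suc (a h) + (\<Sum>i\<in>{1..<h}. a i)"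
    unfolding split_h using even odd by simp
  also have "\<dots> = ?n" unfolding starlike_tree_card[OF starlike] split_h by simp
  finally have card: "?n = 2 * card ?K" ..
  \<comment> \<open>Pairs are numbered from the leaf; in branch \<open>h\<close> the last one
    consists of \<open>p h 1\<close> and the centre.\<close>
  define \<Phi> where
    "\<Phi> = (\<lambda>(i, m) x. x (p i (a i - 2 * m)) + x (p i (a i - Suc (2 * m))) :: real)"
  have "length ?vs - card ?K
      \<le> size (filter_mset (\<lambda>\<mu>. - 1 * \<mu> \<le> - 1 * 2) spectrum_mset)"
  proof (rule eigenvalue_count_ge[where \<Phi> = \<Phi>])
    show "\<Phi> k (\<lambda>v. \<Sum>r\<in>R. \<alpha> r * w r v) = (\<Sum>r\<in>R. \<alpha> r * \<Phi> k (w r))"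
      for k and R :: "nat set" and \<alpha> w
      by (simp add: \<Phi>_def split_def sum.distrib distrib_left)
    fix x assume zero: "\<And>k. k \<in> ?K \<Longrightarrow> \<Phi> k x = 0"
    have branch: "2 * (\<Sum>j<2 * (Suc (a i) div 2). (x (p i (a i - j)))\<^sup>2)
        \<le> (\<Sum>j<a i. (x (p i j) - x (p i (Suc j)))\<^sup>2)" if "i \<in> {1..h}" for i
    proof -
      have "x (p i (a i - 2 * m)) + x (p i (a i - Suc (2 * m))) = 0" if "m < Suc (a i) div 2" for m
        using zero[of "(i, m)"] that \<open>i \<in> {1..h}\<close> by (simp add: \<Phi>_def)
      from path_form_ge[of "a i" "\<lambda>j. x (p i (a i - j))", OF this] show ?thesis
        by (simp add: branch_form_rev)
    qed
    have "2 * (\<Sum>j=1..a i. (x (p i j))\<^sup>2) \<le> (\<Sum>j<a i. (x (p i j) - x (p i (Suc j)))\<^sup>2)"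
      if "i \<in> {1..<h}" for i
      using branch[of i] even[OF that] that sum_lessThan_rev[of "\<lambda>j. (x (p i j))\<^sup>2" "a i"]
      by simp
    then have "(\<Sum>i\<in>{1..<h}. 2 * (\<Sum>j=1..a i. (x (p i j))\<^sup>2))
        \<le> (\<Sum>i\<in>{1..<h}. \<Sum>j<a i. (x (p i j) - x (p i (Suc j)))\<^sup>2)"
      by (rule sum_mono)
    moreover have "2 * ((x u)\<^sup>2 + (\<Sum>j=1..a h. (x (p h j))\<^sup>2))
        \<le> (\<Sum>j<a h. (x (p h j) - x (p h (Suc j)))\<^sup>2)"
      using branch[of h] odd h sum_lessThan_rev[of "\<lambda>j. (x (p h j))\<^sup>2" "a h"] branch_zero[of h]
      by simp
    ultimately have "2 * (\<Sum>v\<in>pverts G. (x v)\<^sup>2)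
        \<le> (\<Sum>i=1..h. \<Sum>j<a i. (x (p i j) - x (p i (Suc j)))\<^sup>2)"
      unfolding sum_verts split_h by (simp add: sum_distrib_left[symmetric])
    then show "- 1 * (\<Sum>v\<in>set ?vs. \<Sum>t\<in>set ?vs. laplacian_entry G v t * x v * x t)
        \<le> - 1 * (2 * (\<Sum>v\<in>set ?vs. (x v)\<^sup>2))"
      unfolding vs(2) quadratic_form by simp
  qed (use vs(1) laplacian_entry_commute[OF sym_arcs] in auto)
  then show ?thesis using card by (simp add: vs(3))
qed

text \<open>
  The centre is constrained to \<open>0\<close>, which decouples the branches, and at odd distances from the
  leaf \<open>x\<close> is required to satisfy the eigenvalue equation for \<open>2 - \<epsilon>\<close>.
\<close>

lemma eigenvalues_le:
  assumes even: "\<And>i. i \<in> {1..<h} \<Longrightarrow> even (a i)" and odd: "odd (a h)"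
    and \<epsilon>: "0 \<le> \<epsilon>" "\<And>i. i \<in> {1..<h} \<Longrightarrow> \<epsilon> * (real (a i) + 2) \<le> 2" "\<epsilon> * (real (a h) + 1) \<le> 1"
  shows "card (pverts G) div 2 \<le> size (filter_mset (\<lambda>\<mu>. \<mu> \<le> 2 - \<epsilon>) spectrum_mset)"
proof -
  let ?n = "card (pverts G)" and ?vs = "vertex_enum G"
  note vs = vertex_enum[OF finite_verts]
  have split_h: "{1..h} = insert h {1..<h}" using h by auto
  let ?S = "SIGMA i:{1..h}. {..<a i div 2}"
  \<comment> \<open>Branches are numbered from 1, so the key (0, 0) is free to stand for the
    constraint at the centre. It makes up for the rounding in the odd branch, and the total is n /
    2.\<close>
  let ?K = "insert (0, 0) ?S"
  have "2 * card ?K = 2 + (\<Sum>i=1..h. 2 * (a i div 2))" by (simp add: sum_distrib_left)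
  also have "(\<Sum>i=1..h. 2 * (a i div 2)) = a h - 1 + (\<Sum>i\<in>{1..<h}. a i)"
    unfolding split_h using even odd by simp
  also have "2 + \<dots> = ?n"
    unfolding starlike_tree_card[OF starlike] split_h using branch_pos[of h] h by simp
  finally have card: "?n = 2 * card ?K" ..
  define \<Phi> where
    "\<Phi> = (\<lambda>(i, m) x. if i = 0 then x u else x (p i (a i - 2 * m))
      + x (p i (a i - Suc (Suc (2 * m)))) - \<epsilon> * x (p i (a i - Suc (2 * m))) :: real)"
  have "length ?vs - card ?K
      \<le> size (filter_mset (\<lambda>\<mu>. 1 * \<mu> \<le> 1 * (2 - \<epsilon>)) spectrum_mset)"
  proof (rule eigenvalue_count_ge[where \<Phi> = \<Phi>])
    show "\<Phi> k (\<lambda>v. \<Sum>r\<in>R. \<alpha> r * w r v) = (\<Sum>r\<in>R. \<alpha> r * \<Phi> k (w r))"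
      for k and R :: "nat set" and \<alpha> w
      by (simp add: \<Phi>_def split_def sum.distrib sum_subtractf sum_distrib_left algebra_simps)
    fix x assume zero: "\<And>k. k \<in> ?K \<Longrightarrow> \<Phi> k x = 0"
    have u0: "x u = 0" using zero[of "(0, 0)"] by (simp add: \<Phi>_def)
    have "(\<Sum>j<a i. (x (p i j) - x (p i (Suc j)))\<^sup>2) \<le> (2 - \<epsilon>) * (\<Sum>j=1..a i. (x (p i j))\<^sup>2)"
      if i: "i \<in> {1..h}" for i
    proof -
      have "(\<Sum>j<a i. (x (p i (a i - j)) - x (p i (a i - Suc j)))\<^sup>2)
          \<le> (2 - \<epsilon>) * (\<Sum>j<a i. (x (p i (a i - j)))\<^sup>2)"
      proof (rule path_form_le)
        show "x (p i (a i - a i)) = 0" using branch_zero[OF i] u0 by simp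
        show "x (p i (a i - 2 * m)) + x (p i (a i - Suc (Suc (2 * m))))
            = \<epsilon> * x (p i (a i - Suc (2 * m)))" if "m < a i div 2" for m
          using zero[of "(i, m)"] that i by (auto simp: \<Phi>_def)
        show "\<epsilon> * (real (a i) + 2) \<le> 2" if "even (a i)"
          using that odd i \<epsilon>(2)[of i] by (cases "i = h") auto
        show "\<epsilon> * (real (a i) + 1) \<le> 1" if "odd (a i)"
          using that even[of i] i \<epsilon>(3) by (cases "i = h") auto
      qed (use \<epsilon>(1) branch_pos[OF i] in auto)
      then show ?thesis
        unfolding branch_form_rev sum_lessThan_rev[of "\<lambda>j. (x (p i j))\<^sup>2" "a i"] .
    qed
    then have "(\<Sum>i=1..h. \<Sum>j<a i. (x (p i j) - x (p i (Suc j)))\<^sup>2)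
        \<le> (\<Sum>i=1..h. (2 - \<epsilon>) * (\<Sum>j=1..a i. (x (p i j))\<^sup>2))"
      by (rule sum_mono)
    then show "1 * (\<Sum>v\<in>set ?vs. \<Sum>t\<in>set ?vs. laplacian_entry G v t * x v * x t)
        \<le> 1 * ((2 - \<epsilon>) * (\<Sum>v\<in>set ?vs. (x v)\<^sup>2))"
      unfolding vs(2) quadratic_form unfolding sum_verts by (simp add: sum_distrib_left u0)
  qed (use vs(1) laplacian_entry_commute[OF sym_arcs] in auto)
  then show ?thesis using card by (simp add: vs(3))
qed

end
section \<open>Joining the ends of two branches of equal length\<close>

text \<open>\<bar>\<mu> - c\<bar> is the square root of (\<mu> - c)^2.\<close>

lemma sum_abs_diff_from_square:
  fixes M N :: "real multiset"
  assumes "image_mset (\<lambda>\<mu>. (\<mu> - c)\<^sup>2) M = image_mset (\<lambda>\<mu>. (\<mu> - c)\<^sup>2) N"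
  shows "(\<Sum>\<mu>\<in>#M. \<bar>\<mu> - c\<bar>) = (\<Sum>\<mu>\<in>#N. \<bar>\<mu> - c\<bar>)"
  using arg_cong[OF assms, of "\<lambda>X. \<Sum>\<nu>\<in>#X. sqrt \<nu>"]
  by (simp add: image_mset.compositionality o_def)

section \<open>Exchanging two branches at selected distances\<close>

locale starlike_two_equal = starlike +
  fixes b c k :: nat
  assumes b: "b \<in> {1..h}" "a b = k" and c: "c \<in> {1..h}" "a c = k" and bc: "b \<noteq> c"
    and k2: "2 \<le> k" and even_k: "even k"
begin

abbreviation swap_bc :: "nat \<Rightarrow> nat" where
  "swap_bc \<equiv> Transposition.transpose b c"

lemma swap_bc_in: "i \<in> {1..h} \<Longrightarrow> swap_bc i \<in> {1..h}"
  using b c by (auto simp: Transposition.transpose_def)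

lemma a_swap_bc: "a (swap_bc i) = a i"
  using b c by (auto simp: Transposition.transpose_def)

text \<open>\<open>Q\<close> selects the distances from the centre at which the branches
  \<open>b\<close> and \<open>c\<close> are exchanged. The choice is over coordinates of
  \<open>v\<close>, which are ambiguous only at the centre, and there every choice gives the centre
  again.\<close>

definition swap :: "(nat \<Rightarrow> bool) \<Rightarrow> 'a \<Rightarrow> 'a" where
  "swap Q v = (SOME w. \<exists>i\<in>{1..h}. \<exists>j\<le>a i. v = p i j \<and> w = p (if Q j then swap_bc i else i) j)"

lemma swap_p:
  assumes "i \<in> {1..h}" "j \<le> a i"
  shows "swap Q (p i j) = p (if Q j then swap_bc i else i) j"
  unfolding swap_def
proof (rule some_equality)
  show "\<exists>r\<in>{1..h}. \<exists>s\<le>a r. p i j = p r s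
      \<and> p (if Q j then swap_bc i else i) j = p (if Q s then swap_bc r else r) s"
    using assms by blast
next
  fix w assume "\<exists>r\<in>{1..h}. \<exists>s\<le>a r. p i j = p r s \<and> w = p (if Q s then swap_bc r else r) s"
  then obtain r s where rs: "r \<in> {1..h}" "s \<le> a r" "p i j = p r s"
    "w = p (if Q s then swap_bc r else r) s" by blast
  then have "j = 0 \<and> s = 0 \<or> i = r \<and> j = s" using assms by (simp add: p_eq_iff)
  then show "w = p (if Q j then swap_bc i else i) j"
    using rs(1,4) assms(1) branch_zero swap_bc_in by metis
qed

lemma swap_in:
  assumes "v \<in> pverts G"
  shows "swap Q v \<in> pverts G"
proof -
  obtain i j where ij: "i \<in> {1..h}" "j \<le> a i" "v = p i j" using assms vert_iff by auto
  let ?q = "if Q j then swap_bc i else i"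
  have "?q \<in> {1..h}" "j \<le> a ?q" using ij swap_bc_in by (auto simp: a_swap_bc)
  then show ?thesis unfolding ij(3) swap_p[OF ij(1,2)] vert_iff by blast
qed

text \<open>Selections combine by symmetric difference: hence all swaps commute and are involutions,
  and \<open>swap odd\<close> followed by \<open>swap even\<close> exchanges the branches
  entirely.\<close>

lemma swap_swap:
  assumes "v \<in> pverts G"
  shows "swap Q (swap R v) = swap (\<lambda>j. Q j \<noteq> R j) v"
proof -
  obtain i j where ij: "i \<in> {1..h}" "j \<le> a i" "v = p i j" using assms vert_iff by auto
  then show ?thesis using swap_bc_in[OF ij(1)] by (simp add: swap_p a_swap_bc)
qed

lemma swap_False: "v \<in> pverts G \<Longrightarrow> swap (\<lambda>_. False) v = v"
  unfolding vert_iff by (auto simp: swap_p)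

lemma bij_betw_swap: "bij_betw (swap Q) (pverts G) (pverts G)"
  by (rule bij_betwI[where g = "swap Q"]) (auto simp: swap_in swap_swap swap_False)

section \<open>Effect of the additional edge on the shifted Laplacian\<close>

abbreviation (input) joined :: "'a pair_pre_digraph" where
  "joined \<equiv> add_edge G (p b k) (p c k)"

lemma ends: "b \<in> {1..h}" "c \<in> {1..h}" "k \<le> a b" "k \<le> a c"
  using b c by auto

lemma ends_neq: "p b k \<noteq> p c k" and ends_not_arc: "(p b k, p c k) \<notin> parcs G" "(p c k, p b k) \<notin> parcs G"
  using ends k2 bc by (auto simp: p_eq_iff arc_iff)

lemma pverts_add: "pverts joined = pverts G"
  by (simp add: add_edge_def)

lemma parcs_add: "parcs joined = parcs G \<union> {(p b k, p c k), (p c k, p b k)}"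
  by (simp add: add_edge_def)

lemma finite_arcs: "finite (parcs G)"
  using finite_verts arcs_subset finite_subset by blast

lemma degree_add:
  "vertex_degree joined v = vertex_degree G v + (if v = p b k \<or> v = p c k then 1 else 0)"
proof -
  let ?N = "if v = p b k then {(p b k, p c k)} else if v = p c k then {(p c k, p b k)} else {}"
  have "{e \<in> parcs joined. fst e = v} = {e \<in> parcs G. fst e = v} \<union> ?N"
    unfolding parcs_add by auto
  moreover have "{e \<in> parcs G. fst e = v} \<inter> ?N = {}" using ends_not_arc by auto
  ultimately show ?thesis
    unfolding vertex_degree_eq_card using finite_arcs by (simp add: card_Un_disjoint)
qed

definition shifted :: "'a pair_pre_digraph \<Rightarrow> 'a \<Rightarrow> 'a \<Rightarrow> real" where
  "shifted H v w = laplacian_entry H v w - (if v = w then 2 else 0)"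

lemma shifted_eq:
  "shifted H v w = (if v = w then real (vertex_degree H v) - 2 else 0)
    - (if (v, w) \<in> parcs H then 1 else 0)"
  by (simp add: shifted_def laplacian_entry_def)

lemma shifted_p:
  assumes "i \<in> {1..h}" "i' \<in> {1..h}" "j \<le> a i" "j' \<le> a i'"
  shows "shifted G (p i j) (p i' j')
    = (if j = 0 \<and> j' = 0 then real (vertex_degree G u) - 2
       else if i = i' \<and> j = j' \<and> j = a i then - 1 else 0)
      - (if j' = Suc j \<and> (i = i' \<or> j = 0) \<or> j = Suc j' \<and> (i = i' \<or> j' = 0) then 1 else 0)"
proof -
  have "(if p i j = p i' j' then real (vertex_degree G (p i j)) - 2 else 0)
      = (if j = 0 \<and> j' = 0 then real (vertex_degree G u) - 2
         else if i = i' \<and> j = j' \<and> j = a i then - 1 else 0)"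
  proof (cases "j = 0")
    case True
    then show ?thesis
      unfolding p_eq_iff[OF assms] using branch_zero[OF assms(1)] branch_pos[OF assms(1)] by auto
  next
    case False
    then have "real (vertex_degree G (p i j)) - 2 = (if j = a i then - 1 else 0)"
      using degree[of i j] assms by simp
    then show ?thesis unfolding p_eq_iff[OF assms] using False by presburger
  qed
  then show ?thesis unfolding shifted_eq arc_iff[OF assms] by (rule arg_cong)
qed

text \<open>The two ends are leaves with diagonal entry -1 in \<open>shifted G\<close>. The new edge
  turns these into 0 and puts -1 between the ends, just as exchanging the two columns would.\<close>

lemma shifted_add:
  "shifted joined v w = shifted G v w + (if v = w \<and> (v = p b k \<or> v = p c k) then 1 else 0)
    - (if v = p b k \<and> w = p c k \<or> v = p c k \<and> w = p b k then 1 else 0)"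
  using ends_not_arc ends_neq
  by (auto simp: shifted_def laplacian_entry_def degree_add parcs_add)

lemma shifted_swap:
  assumes "v \<in> pverts G" "w \<in> pverts G"
  shows "shifted G (swap (\<lambda>_. True) v) (swap (\<lambda>_. True) w) = shifted G v w"
proof -
  obtain i j i' j' where ij: "i \<in> {1..h}" "j \<le> a i" "v = p i j"
    "i' \<in> {1..h}" "j' \<le> a i'" "w = p i' j'" using assms vert_iff by auto
  have "swap_bc i = swap_bc i' \<longleftrightarrow> i = i'" by (metis transpose_involutory)
  then show ?thesis using ij swap_bc_in[OF ij(1)] swap_bc_in[OF ij(4)]
    by (simp add: swap_p shifted_p a_swap_bc)
qed

text \<open>
  On functions symmetric in the two branches both Laplacians agree, and on antisymmetric ones
  \<open>x\<^sub>j \<mapsto> (-1)\<^sup>j x\<^sub>j\<close> turns \<open>L - 2\<close> into \<open>- (L' - 2)\<close>. Changing that sign on the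
  antisymmetric part only amounts to swapping the two branches at odd distances from the centre.
\<close>

lemma shifted_add_eq_swap:
  assumes "v \<in> pverts G" "w \<in> pverts G"
  shows "shifted joined v w = shifted G (swap odd v) (swap even w)"
proof -
  obtain i j i' j' where ij: "i \<in> {1..h}" "j \<le> a i" "v = p i j"
    "i' \<in> {1..h}" "j' \<le> a i'" "w = p i' j'" using assms vert_iff by auto
  define q q' where "q = (if odd j then swap_bc i else i)" and "q' = (if even j' then swap_bc i' else i')"
  have q: "q \<in> {1..h}" "j \<le> a q" "q' \<in> {1..h}" "j' \<le> a q'"
    using ij swap_bc_in by (auto simp: q_def q'_def a_swap_bc)
  have v: "v = p r k \<longleftrightarrow> i = r \<and> j = k" and w: "w = p r k \<longleftrightarrow> i' = r \<and> j' = k"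
    if "r \<in> {1..h}" "k \<le> a r" for r
    using p_eq_iff[OF ij(1) that(1) ij(2) that(2)] p_eq_iff[OF ij(4) that(1) ij(5) that(2)] k2
    unfolding ij(3,6) by presburger+
  have "v = w \<and> (v = p b k \<or> v = p c k)
      \<longleftrightarrow> v = p b k \<and> w = p b k \<or> v = p c k \<and> w = p c k" by blast
  also have "\<dots> \<longleftrightarrow> i = i' \<and> j = k \<and> j' = k \<and> (i = b \<or> i = c)"
    unfolding v[OF ends(1,3)] v[OF ends(2,4)] w[OF ends(1,3)] w[OF ends(2,4)] by blast
  finally have eq: "v = w \<and> (v = p b k \<or> v = p c k) \<longleftrightarrow> \<dots>" .
  have edge: "v = p b k \<and> w = p c k \<or> v = p c k \<and> w = p b k
      \<longleftrightarrow> j = k \<and> j' = k \<and> (i = b \<and> i' = c \<or> i = c \<and> i' = b)"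
    unfolding v[OF ends(1,3)] v[OF ends(2,4)] w[OF ends(1,3)] w[OF ends(2,4)] by blast
  have "shifted joined v w = shifted G (p i j) (p i' j')
      + (if i = i' \<and> j = k \<and> j' = k \<and> (i = b \<or> i = c) then 1 else 0)
      - (if j = k \<and> j' = k \<and> (i = b \<and> i' = c \<or> i = c \<and> i' = b) then 1 else 0)"
    unfolding shifted_add eq edge unfolding ij(3,6) ..
  also have "\<dots> = shifted G (p q j) (p q' j')"
  proof -
    have s_eq: "swap_bc r = swap_bc r' \<longleftrightarrow> r = r'" for r r' by (metis transpose_involutory)
    note E = shifted_p[OF ij(1,4,2,5)] shifted_p[OF q(1,3,2,4)]
    consider "j' = j" "j = 0" | "j' = j" "j \<noteq> 0" | "j' = Suc j" | "j = Suc j'"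
      | "j' \<noteq> j" "j' \<noteq> Suc j" "j \<noteq> Suc j'" by blast
    then show ?thesis
    proof cases
      case 1
      then show ?thesis unfolding E using k2 by simp
    next
      case 2
      have aq: "a q = a i" by (simp add: q_def a_swap_bc)
      \<comment> \<open>At equal distances exactly one of the two vertices changes branch. This
        moves the leaf entries of \<open>b\<close> and \<open>c\<close> off the diagonal and leaves
        other branches alone.\<close>
      have qq: "q = q' \<longleftrightarrow> i = swap_bc i'"
        using 2 by (auto simp: q_def q'_def transpose_eq_iff)
      show ?thesis
      proof (cases "i = b \<or> i = c")
        case True
        then have "a i = k" "i = swap_bc i' \<longleftrightarrow> i = b \<and> i' = c \<or> i = c \<and> i' = b"
          using b c bc by (auto simp: Transposition.transpose_def)
        then show ?thesis unfolding E qq aq using 2 True bc by auto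
      next
        case False
        then have "i = swap_bc i' \<longleftrightarrow> i = i'" by (auto simp: Transposition.transpose_def)
        then show ?thesis unfolding E qq aq using 2 False by simp
      qed
    next
      case 3
      \<comment> \<open>Consecutive distances have opposite parity, so either both vertices change
        branch or neither does, and adjacency is kept.\<close>
      then have "q = q' \<longleftrightarrow> i = i'" by (simp add: q_def q'_def s_eq)
      then show ?thesis unfolding E using 3 by simp
    next
      case 4
      then have "q = q' \<longleftrightarrow> i = i'" by (simp add: q_def q'_def s_eq)
      then show ?thesis unfolding E using 4 by simp
    next
      case 5
      then show ?thesis unfolding E by auto
    qed
  qed
  also have "\<dots> = shifted G (swap odd v) (swap even w)"
    using ij by (simp add: swap_p q_def q'_def)
  finally show ?thesis .
qed

text \<open>Let M be \<open>shifted G\<close> and P, Q, \<tau> the permutation matrices of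
  \<open>swap odd\<close>, \<open>swap even\<close> and their product. By
  \<open>shifted_swap\<close>, \<tau> commutes with M, so (P M Q)^2 = P M \<tau> M Q = P M^2 \<tau>
  Q = P M^2 P.\<close>

lemma shifted_square:
  assumes "v \<in> pverts G" "w \<in> pverts G"
  shows "(\<Sum>t\<in>pverts G. shifted joined v t * shifted joined t w)
    = (\<Sum>t\<in>pverts G. shifted G (swap odd v) t * shifted G t (swap odd w))"
proof -
  let ?V = "pverts G" and ?\<tau> = "swap (\<lambda>_. True)"
  have "(\<Sum>t\<in>?V. shifted joined v t * shifted joined t w)
      = (\<Sum>t\<in>?V. shifted G (swap odd v) (swap even t) * shifted G (swap odd t) (swap even w))"
    using assms by (intro sum.cong) (auto simp: shifted_add_eq_swap)
  also have "\<dots> = (\<Sum>t\<in>?V. shifted G (swap odd v) (?\<tau> (swap odd t))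
      * shifted G (?\<tau> (swap odd t)) (swap odd w))"
  proof (intro sum.cong refl)
    fix t assume t: "t \<in> ?V"
    have "shifted G (swap odd t) (swap even w)
        = shifted G (?\<tau> (swap odd t)) (?\<tau> (swap even w))"
      using t assms by (simp add: shifted_swap swap_in)
    then show "shifted G (swap odd v) (swap even t) * shifted G (swap odd t) (swap even w)
        = shifted G (swap odd v) (?\<tau> (swap odd t)) * shifted G (?\<tau> (swap odd t)) (swap odd w)"
      using t assms by (simp add: swap_swap)
  qed
  also have "\<dots> = (\<Sum>t\<in>?V. shifted G (swap odd v) t * shifted G t (swap odd w))"
    using sum.reindex_bij_betw[OF bij_betw_trans[OF bij_betw_swap bij_betw_swap],
        of "\<lambda>t. shifted G (swap odd v) t * shifted G t (swap odd w)" "\<lambda>_. True" odd]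
    by simp
  finally show ?thesis .
qed

text \<open>The enumeration is chosen from the vertex set alone, so both Laplacians can be compared
  entry by entry.\<close>

lemma vertex_enum_add: "vertex_enum joined = vertex_enum G"
  by (simp add: vertex_enum_def pverts_add)

lemma laplacian_spectrum_eq:
  "laplacian_spectrum G = proots (char_poly (indexed_mat (vertex_enum G) (laplacian_entry G)))"
  "laplacian_spectrum joined = proots (char_poly (indexed_mat (vertex_enum G) (laplacian_entry joined)))"
  using vertex_enum(1)[OF finite_verts]
  by (simp_all add: laplacian_spectrum_def vertex_enum_add laplacian_mat_eq_indexed_mat)

lemma sum_abs_spectrum_add:
  "(\<Sum>\<mu>\<in>#laplacian_spectrum joined. \<bar>\<mu> - 2\<bar>) = (\<Sum>\<mu>\<in>#laplacian_spectrum G. \<bar>\<mu> - 2\<bar>)"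
proof (rule sum_abs_diff_from_square)
  let ?vs = "vertex_enum G" and ?V = "pverts G"
  note vs = vertex_enum[OF finite_verts]
  let ?sq = "\<lambda>H v w. \<Sum>t\<in>?V. shifted H v t * shifted H t w"
  have symjoined: "sym (parcs joined)" using sym_arcs unfolding parcs_add sym_def by auto
  have mem: "?vs ! i \<in> ?V" if "i < length ?vs" for i
    using nth_mem[OF that] vs(2) by simp
  have sq: "proots (char_poly (indexed_mat ?vs (?sq H)))
      = image_mset (\<lambda>\<mu>. (\<mu> - 2)\<^sup>2) (proots (char_poly (indexed_mat ?vs (laplacian_entry H))))"
    if "sym (parcs H)" for H
    using proots_char_poly_square[where xs = ?vs and E = "laplacian_entry H" and B = "shifted H" and c = 2,
        OF vs(1) laplacian_entry_commute[OF that] shifted_def]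
    unfolding vs(2) .
  \<comment> \<open>Conjugation by \<open>swap odd\<close> appears as a reordered enumeration of the
    vertices.\<close>
  have "indexed_mat ?vs (?sq joined) = indexed_mat (map (swap odd) ?vs) (?sq G)"
    by (rule eq_matI) (simp_all add: shifted_square mem)
  also have "char_poly \<dots> = char_poly (indexed_mat ?vs (?sq G))"
  proof (rule char_poly_indexed_mat)
    show "distinct (map (swap odd) ?vs)" "set (map (swap odd) ?vs) = set ?vs"
      using bij_betw_swap[of odd] vs(1,2) by (simp_all add: distinct_map bij_betw_def)
  qed (rule vs(1))
  finally have "char_poly (indexed_mat ?vs (?sq joined)) = char_poly (indexed_mat ?vs (?sq G))" .
  then show "image_mset (\<lambda>\<mu>. (\<mu> - 2)\<^sup>2) (laplacian_spectrum joined)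
      = image_mset (\<lambda>\<mu>. (\<mu> - 2)\<^sup>2) (laplacian_spectrum G)"
    unfolding laplacian_spectrum_eq sq[OF symjoined, symmetric] sq[OF sym_arcs, symmetric] by simp
qed

lemma average_degree_add: "average_degree joined = average_degree G + 2 / real (card (pverts G))"
proof -
  have sub: "parcs joined \<subseteq> pverts joined \<times> pverts joined"
    using arcs_subset ends vert_iff unfolding parcs_add pverts_add by blast
  have "card (parcs joined) = card (parcs G) + 2"
    unfolding parcs_add using finite_arcs ends_not_arc ends_neq
    by (subst card_Un_disjoint) auto
  then show ?thesis
    using average_degree_eq_card_arcs[OF finite_verts arcs_subset]
      average_degree_eq_card_arcs[OF _ sub] finite_verts
    by (simp add: pverts_add add_divide_distrib)
qed

end

theorem theorem1p2:
  fixes G G' :: "'a pair_pre_digraph" and u :: 'a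
    and n k h :: nat and a :: "nat \<Rightarrow> nat" and p :: "nat \<Rightarrow> nat \<Rightarrow> 'a"
  assumes "0 < n" and "0 < k" and "3 \<le> h"
    and "starlike_tree G u h a p"
    and "card (pverts G) = n"
    and "\<And>i. 1 \<le> i \<Longrightarrow> i \<le> h - 1 \<Longrightarrow> even (a i)"
    and "a 1 = k" and "a 2 = k" and "2 \<le> k"
    and "odd (a h)" and "real (a h) < real n / 2"
    and "G' = add_edge G (p 1 k) (p 2 k)"
  shows "laplacian_energy G = laplacian_energy G'"
proof -
  have "even k" using assms(6)[of 1] assms(3,7) by simp
  interpret starlike_two_equal G u h a p 1 2 k
    by unfold_locales (use assms \<open>even k\<close> in auto)
  have even: "even (a i)" if "i \<in> {1..<h}" for i using assms(6)[of i] that by auto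
  have split_h: "{1..h} = insert h {1..<h}" using assms(3) by auto
  have n: "n = 1 + a h + (\<Sum>i\<in>{1..<h}. a i)"
    using starlike_tree_card[OF assms(4)] assms(5) unfolding split_h by simp
  moreover have "even (\<Sum>i\<in>{1..<h}. a i)" using even by (intro dvd_sum) auto
  ultimately have "even n" using assms(10) by simp
  then obtain q where q: "n = 2 * q" by (auto elim: evenE)
  define \<epsilon> where "\<epsilon> = 2 / real n"
  have \<epsilon>: "0 < \<epsilon>" using assms(1) by (simp add: \<epsilon>_def)
  have avg: "average_degree G = 2 - \<epsilon>" "average_degree G' = 2"
  proof -
    show "average_degree G = 2 - \<epsilon>"
      using average_degree_eq_card_arcs[OF finite_verts arcs_subset] card_arcs assms(1,5)
      by (simp add: \<epsilon>_def field_simps)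
    then show "average_degree G' = 2" using average_degree_add assms(5,12) by (simp add: \<epsilon>_def)
  qed
  have "\<epsilon> * (real (a i) + 2) \<le> 2" if "i \<in> {1..<h}" for i
  proof -
    \<comment> \<open>The centre and at least one vertex of the odd branch lie outside branch
      \<open>i\<close>.\<close>
    have "a i + 2 \<le> n"
      using n assms(10) that member_le_sum[of i "{1..<h}" a] odd_pos[of "a h"] by simp
    then have "real (a i) + 2 \<le> real n" by linarith
    then show ?thesis using assms(1) by (simp add: \<epsilon>_def field_simps)
  qed
  moreover have "\<epsilon> * (real (a h) + 1) \<le> 1"
  proof -
    \<comment> \<open>As n / 2 is the integer \<open>q\<close>, the strict bound gains a whole unit:
      a_h + 1 \<le> n / 2.\<close>
    have "a h < q" using assms(11) q by simp
    then have "2 * a h + 2 \<le> n" using q by simp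
    then have "2 * real (a h) + 2 \<le> real n" by linarith
    then show ?thesis using assms(1) by (simp add: \<epsilon>_def field_simps)
  qed
  ultimately have "q \<le> size (filter_mset (\<lambda>\<mu>. \<mu> \<le> 2 - \<epsilon>) (laplacian_spectrum G))"
    using eigenvalues_le[of \<epsilon>] even assms(5,10) \<epsilon> q unfolding laplacian_spectrum_eq by simp
  moreover have "q \<le> size (filter_mset (\<lambda>\<mu>. 2 \<le> \<mu>) (laplacian_spectrum G))"
    using eigenvalues_ge_2 even assms(5,10) q unfolding laplacian_spectrum_eq by simp
  moreover have "size (laplacian_spectrum G) = 2 * q"
    using size_laplacian_spectrum[OF pair_graph] assms(5) q by simp
  ultimately have "laplacian_energy G = (\<Sum>\<mu>\<in>#laplacian_spectrum G. \<bar>\<mu> - 2\<bar>)"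
    unfolding laplacian_energy_def avg using \<epsilon> by (intro sum_abs_diff_eq[of _ q]) auto
  also have "\<dots> = laplacian_energy G'"
    unfolding laplacian_energy_def avg using sum_abs_spectrum_add assms(12) by simp
  finally show ?thesis .
qed

end
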